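(* Let $\mathcal{H}$ be a real Hilbert space and $V:\mathcal{H}\to\mathcal{H}$ a monotone and continuous operator. Let $r\in(0,1]$, $\alpha,\theta>0$ be such that - if $r\in(0,1)$, then $\frac2\alpha<\theta$; - if $r=1$, then $\frac{2}{\alpha+1}\le\theta<\frac14$. Let $(\beta_k)_{k\ge0}$ be a positive, nondecreasing sequence such that for some positive integer $k_0$ $$\sup_{k\ge k_0}k^{r}\left(\frac{\beta_k-\beta_{k-1}}{\beta_k}+\frac{2r}{k}\right)<\frac{1}{2\theta}.$$ Let $z^0,z^1\in\mathcal{H}$ and let $(z^k)_{k\ge2}$ be generated by the implicit algorithm: for all $k\ge1$, $$z^{k+1}=z^k+\frac{k^{r}}{\alpha-rk^{r-1}+(k+1)^{r}}\bigl(z^k-z^{k-1}\bigr)-\frac{\theta k^{2r}\beta_{k-1}}{\alpha-rk^{r-1}+(k+1)^{r}}\bigl[V(z^{k+1})-V(z^k)\bigr]-\frac{\theta\bigl\{[(k+1)^{2r}-k^{2r}]-2rk^{2r-1}\bigr\}+k^{r}}{\alpha-rk^{r-1}+(k+1)^{r}}\,\beta_kV(z^{k+1}).$$ Let $z_*$ be a zero of $V$. If $r=1$, or ($r\in(0,1)$ and $(z^k)_{k\ge2}$ is bounded), then, as $k\to+\infty$, $$\|V(z^k)\|=o\left(\frac{1}{k^{2r}\beta_k}\right),\quad \langle z^k-z_*,V(z^k)\rangle=o\left(\frac{1}{k^{2r}\beta_k}\right),\quad \|z^k-z^{k-1}\|=o\left(\frac{1}{k^{r}}\right),$$ and $(z^k)_{k\ge2}$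 converges weakly in $\mathcal{H}$ to a zero of $V$ as $k\to+\infty$.
   Context: An operator $V:\mathcal{H}\to\mathcal{H}$ is monotone if $\langle V(x)-V(y),x-y\rangle\ge0$ for all $x,y\in\mathcal{H}$. A zero of $V$ is a point $z_*$ with $V(z_* )=0$. For positive $b_k$, $a_k=o(b_k)$ as $k\to+\infty$ means $a_k/b_k\to0$. *)

theory Defs
  imports "HOL-Analysis.Analysis" "HOL-Library.Landau_Symbols"
begin

definition monotone_operator :: "('a::real_inner \<Rightarrow> 'a) \<Rightarrow> bool" where
  "monotone_operator V \<longleftrightarrow> (\<forall>x y. inner (V x - V y) (x - y) \<ge> 0)"

text \<open>
  Weak convergence in a real Hilbert space: the weak topology is the coarsest topology that makes
  all the functionals \<open>x \<mapsto> \<langle>x, u\<rangle>\<close> continuous.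
\<close>

definition weakly_converges_to :: "(nat \<Rightarrow> 'a::real_inner) \<Rightarrow> 'a \<Rightarrow> bool" where
  "weakly_converges_to z l \<longleftrightarrow> (\<forall>u. (\<lambda>k. inner (z k) u) \<longlonglongrightarrow> inner l u)"

end

theory Submission
  imports Defs "HOL-Real_Asymp.Real_Asymp"
begin

text \<open>
  Write \<open>s\<^sub>k = k\<^sup>r\<close>, \<open>m\<^sub>k = \<theta> s\<^sub>k\<^sup>2 \<beta>\<^sub>k\<^sub>-\<^sub>1\<close> and \<open>p\<^sub>k = s\<^sub>k (z\<^sup>k - z\<^sup>k\<^sup>-\<^sup>1) + m\<^sub>k V(z\<^sup>k)\<close>. Clearing denominators, the algorithm reads
  \<open>p\<^sub>k = p\<^sub>k\<^sub>+\<^sub>1 + c\<^sub>k (z\<^sup>k\<^sup>+\<^sup>1 - z\<^sup>k) + s\<^sub>k \<beta>\<^sub>k g\<^sub>k V(z\<^sup>k\<^sup>+\<^sup>1)\<close> with \<open>c\<^sub>k \<longlonglongrightarrow> C\<close> and, eventually,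
  \<open>1/2 \<le> g\<^sub>k \<le> 1\<close>. For a zero \<open>a\<close> of \<open>V\<close> put
  \<open>\<Phi>\<^sub>k = c\<^sub>k/2 \<parallel>z\<^sup>k - a\<parallel>\<^sup>2 + \<langle>z\<^sup>k - a, p\<^sub>k\<rangle>\<close> and
  \<open>\<Psi>\<^sub>k = 1/2 \<parallel>p\<^sub>k - m\<^sub>k/2 V(z\<^sup>k)\<parallel>\<^sup>2 + 1/8 \<parallel>m\<^sub>k V(z\<^sup>k)\<parallel>\<^sup>2\<close>. For two different values of \<open>l\<close> the energy
  \<open>l \<Phi> + \<Psi>\<close> is bounded below and, up to summable errors, decreases by a multiple of
  \<open>s\<^sub>k\<^sub>+\<^sub>1 (\<parallel>z\<^sup>k\<^sup>+\<^sup>1 - z\<^sup>k\<parallel>\<^sup>2 + \<parallel>s\<^sub>k\<^sub>+\<^sub>1 \<beta>\<^sub>k V(z\<^sup>k\<^sup>+\<^sup>1)\<parallel>\<^sup>2)\<close>. Hence \<open>\<Phi>\<close> and \<open>\<Psi>\<close> converge and \<open>\<Psi>\<^sub>k / s\<^sub>k\<close> is summable,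
  while \<open>1 / s\<^sub>k\<close> is not because \<open>r \<le> 1\<close>; so \<open>\<Psi>\<^sub>k \<longlonglongrightarrow> 0\<close>, which gives the rates, and then \<open>\<Phi>\<close> gives convergence
  of \<open>\<parallel>z\<^sup>k - a\<parallel>\<close>. Weak convergence follows by Opial's argument, with asymptotic centres along filters
  in place of weak cluster points.
\<close>

section \<open>Asymptotic centres and weak convergence\<close>

text \<open>\<open>c\<close> minimises the limsup of \<open>(norm (x n - y))\<^sup>2\<close> along
  \<open>F\<close>, with minimum \<open>\<rho>\<close>. Eventual bounds avoid an extended-real
  limsup, and a filter avoids extracting subsequences.\<close>

definition asymptotic_center :: "(nat \<Rightarrow> 'a::real_inner) \<Rightarrow> nat filter \<Rightarrow> 'a \<Rightarrow> real \<Rightarrow> bool" where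
  "asymptotic_center x F c \<rho> \<longleftrightarrow>
     (\<forall>e>0. \<forall>\<^sub>F n in F. (norm (x n - c))\<^sup>2 \<le> \<rho> + e) \<and>
     (\<forall>y R. (\<forall>\<^sub>F n in F. (norm (x n - y))\<^sup>2 \<le> R) \<longrightarrow> \<rho> \<le> R)"

section \<open>Existence and uniqueness of asymptotic centres\<close>

lemma norm_midpoint:
  fixes x a b :: "'a::real_inner"
  shows "(norm (x - midpoint a b))\<^sup>2 = (norm (x - a))\<^sup>2 / 2 + (norm (x - b))\<^sup>2 / 2 - (norm (a - b))\<^sup>2 / 4"
  unfolding midpoint_def power2_norm_eq_inner
  by (simp add: inner_simps inner_commute[of a x] inner_commute[of b x] inner_commute[of b a] field_simps)

text \<open>The midpoint of \<open>a\<close> and \<open>b\<close> would improve the bound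
  \<open>\<rho> + e\<close> by \<open>(norm (a - b))\<^sup>2 / 4\<close>, and no point can do better
  than \<open>\<rho>\<close>.\<close>

lemma near_centers_close:
  fixes x :: "nat \<Rightarrow> 'a::real_inner"
  assumes min: "\<And>y R. (\<forall>\<^sub>F n in F. (norm (x n - y))\<^sup>2 \<le> R) \<Longrightarrow> \<rho> \<le> R"
    and a: "\<forall>\<^sub>F n in F. (norm (x n - a))\<^sup>2 \<le> \<rho> + e" and b: "\<forall>\<^sub>F n in F. (norm (x n - b))\<^sup>2 \<le> \<rho> + e"
  shows "(norm (a - b))\<^sup>2 \<le> 4 * e"
proof -
  have "\<forall>\<^sub>F n in F. (norm (x n - midpoint a b))\<^sup>2 \<le> \<rho> + e - (norm (a - b))\<^sup>2 / 4"
    using a b by eventually_elim (simp add: norm_midpoint)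
  from min[OF this] show ?thesis by simp
qed

text \<open>A minimising sequence is Cauchy by \<open>near_centers_close\<close>; completeness
  supplies its limit, which attains the infimum.\<close>

lemma asymptotic_center_exists:
  fixes x :: "nat \<Rightarrow> 'a::{real_inner, complete_space}"
  assumes F: "F \<noteq> bot" and bd: "\<forall>\<^sub>F n in F. norm (x n) \<le> B"
  obtains c \<rho> where "asymptotic_center x F c \<rho>"
proof -
  define S where "S = {R. \<exists>y. \<forall>\<^sub>F n in F. (norm (x n - y))\<^sup>2 \<le> R}"
  define \<rho> where "\<rho> = Inf S"
  have lower: "0 \<le> R" if R: "R \<in> S" for R
  proof -
    obtain y where "\<forall>\<^sub>F n in F. (norm (x n - y))\<^sup>2 \<le> R" using R unfolding S_def by blast
    from eventually_happens[OF this] F obtain n where "(norm (x n - y))\<^sup>2 \<le> R" by blast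
    thus ?thesis by (rule order_trans[OF zero_le_power2])
  qed
  have "\<forall>\<^sub>F n in F. (norm (x n - 0))\<^sup>2 \<le> B\<^sup>2"
    using bd by eventually_elim (simp add: power_mono)
  hence "B\<^sup>2 \<in> S" unfolding S_def by blast
  hence ne: "S \<noteq> {}" by blast
  have min: "\<rho> \<le> R" if "\<forall>\<^sub>F n in F. (norm (x n - y))\<^sup>2 \<le> R" for y R
    unfolding \<rho>_def using that lower by (intro cInf_lower bdd_belowI[of _ 0]) (auto simp: S_def)
  have "\<exists>y. \<forall>\<^sub>F n in F. (norm (x n - y))\<^sup>2 \<le> \<rho> + inverse (real (Suc j))" for j
  proof -
    have "Inf S < \<rho> + inverse (real (Suc j))" by (simp add: \<rho>_def)
    from cInf_lessD[OF ne this] obtain R where R: "R \<in> S" "R < \<rho> + inverse (real (Suc j))" by blast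
    then obtain y where "\<forall>\<^sub>F n in F. (norm (x n - y))\<^sup>2 \<le> R" unfolding S_def by blast
    hence "\<forall>\<^sub>F n in F. (norm (x n - y))\<^sup>2 \<le> \<rho> + inverse (real (Suc j))"
      by eventually_elim (use R in simp)
    thus ?thesis by blast
  qed
  then obtain y where y: "\<And>j. \<forall>\<^sub>F n in F. (norm (x n - y j))\<^sup>2 \<le> \<rho> + inverse (real (Suc j))" by metis
  have inv: "inverse (real (Suc i)) \<le> inverse (real (Suc N))" if "N \<le> i" for i N
    using that by (intro le_imp_inverse_le) auto
  have close: "(norm (y i - y j))\<^sup>2 \<le> 4 * inverse (real (Suc N))" if "N \<le> i" "N \<le> j" for i j N
  proof (rule near_centers_close[OF min])
    show "\<forall>\<^sub>F n in F. (norm (x n - y i))\<^sup>2 \<le> \<rho> + inverse (real (Suc N))"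
      using y[of i] by eventually_elim (use inv[OF that(1)] inv[OF that(2)] in linarith)
    show "\<forall>\<^sub>F n in F. (norm (x n - y j))\<^sup>2 \<le> \<rho> + inverse (real (Suc N))"
      using y[of j] by eventually_elim (use inv[OF that(1)] inv[OF that(2)] in linarith)
  qed auto
  have "Cauchy y"
  proof (rule CauchyI)
    fix e :: real assume "e > 0"
    hence "0 < e\<^sup>2 / 4" by simp
    from reals_Archimedean[OF this] obtain N where N: "inverse (real (Suc N)) < e\<^sup>2 / 4" by blast
    have "norm (y i - y j) < e" if "N \<le> i" "N \<le> j" for i j
    proof (rule power2_less_imp_less)
      show "(norm (y i - y j))\<^sup>2 < e\<^sup>2" using close[OF that] N by simp
    qed (use \<open>e > 0\<close> in simp)
    thus "\<exists>M. \<forall>m\<ge>M. \<forall>n\<ge>M. norm (y m - y n) < e" by blast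
  qed
  then obtain c where c: "y \<longlonglongrightarrow> c" using Cauchy_convergent convergent_def by blast
  have "\<forall>\<^sub>F n in F. (norm (x n - c))\<^sup>2 \<le> \<rho> + e" if "e > 0" for e
  proof -
    \<comment> \<open>The product bounds
      \<open>(norm (x n - c))\<^sup>2 - (norm (x n - y j))\<^sup>2\<close>, factored as a difference
      of squares, uniformly over \<open>norm (x n) \<le> B\<close>; so one fixed \<open>j\<close>
      serves all such \<open>n\<close>.\<close>
    have "(\<lambda>j. norm (y j - c) * (2 * (B + norm c) + norm (y j - c)) + inverse (real (Suc j)))
        \<longlonglongrightarrow> norm (c - c) * (2 * (B + norm c) + norm (c - c)) + 0"
      by (intro tendsto_intros c LIMSEQ_inverse_real_of_nat)
    hence "\<forall>\<^sub>F j in sequentially. norm (y j - c) * (2 * (B + norm c) + norm (y j - c)) + inverse (real (Suc j)) < e"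
      using that by (intro order_tendstoD) auto
    then obtain j where j: "norm (y j - c) * (2 * (B + norm c) + norm (y j - c)) + inverse (real (Suc j)) < e"
      by (auto dest: eventually_happens)
    show ?thesis using y[of j] bd
    proof eventually_elim
      case (elim n)
      have tri: "norm (x n - c) \<le> norm (x n - y j) + norm (y j - c)"
        using norm_triangle_ineq[of "x n - y j" "y j - c"] by simp
      have b2: "norm (x n - y j) \<le> (B + norm c) + norm (y j - c)"
        using norm_triangle_ineq4[of "x n" c] norm_triangle_ineq4[of "x n - c" "y j - c"] elim(2) by simp
      have b3: "norm (x n - c) \<le> B + norm c"
        using norm_triangle_ineq4[of "x n" c] elim(2) by simp
      have "(norm (x n - c))\<^sup>2 - (norm (x n - y j))\<^sup>2
          = (norm (x n - c) - norm (x n - y j)) * (norm (x n - c) + norm (x n - y j))"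
        by (simp add: power2_eq_square algebra_simps)
      also have "\<dots> \<le> norm (y j - c) * (norm (x n - c) + norm (x n - y j))"
        using tri by (intro mult_right_mono) auto
      also have "\<dots> \<le> norm (y j - c) * (2 * (B + norm c) + norm (y j - c))"
        using b2 b3 by (intro mult_left_mono) auto
      finally show ?case using j elim(1) by linarith
    qed
  qed
  thus ?thesis using min by (intro that[of c \<rho>]) (auto simp: asymptotic_center_def)
qed

lemma asymptotic_center_unique:
  fixes x :: "nat \<Rightarrow> 'a::real_inner"
  assumes c: "asymptotic_center x F c \<rho>" and a: "\<And>e. e > 0 \<Longrightarrow> \<forall>\<^sub>F n in F. (norm (x n - a))\<^sup>2 \<le> \<rho> + e"
  shows "a = c"
proof -
  have "(norm (a - c))\<^sup>2 \<le> 0 + e" if "e > 0" for e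
  proof -
    have e4: "e / 4 > 0" using that by simp
    have "(norm (a - c))\<^sup>2 \<le> 4 * (e / 4)"
      using c a[OF e4] e4 by (intro near_centers_close[where F = F and x = x and \<rho> = \<rho>]) (auto simp: asymptotic_center_def)
    thus ?thesis by simp
  qed
  hence "(norm (a - c))\<^sup>2 \<le> 0" by (rule field_le_epsilon)
  thus ?thesis by simp
qed

text \<open>
  This is what makes asymptotic centres usable like weak limits: otherwise moving \<open>c\<close> along \<open>- w\<close>
  would decrease the radius.
\<close>

lemma asymptotic_center_halfspace:
  fixes x :: "nat \<Rightarrow> 'a::real_inner"
  assumes c: "asymptotic_center x F c \<rho>"
    and w: "\<And>e. e > 0 \<Longrightarrow> \<forall>\<^sub>F n in F. inner w (x n) \<le> t + e"
  shows "inner w c \<le> t"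
proof (rule ccontr)
  assume "\<not> inner w c \<le> t"
  define \<gamma> where "\<gamma> = inner w c - t"
  have \<gamma>: "\<gamma> > 0" using \<open>\<not> inner w c \<le> t\<close> by (simp add: \<gamma>_def)
  have w0: "F \<noteq> bot \<Longrightarrow> w \<noteq> 0"
  proof
    assume F: "F \<noteq> bot" and "w = 0"
    from eventually_happens[OF w[of "\<gamma> / 2"]] F \<open>w = 0\<close> \<gamma> show False by (simp add: \<gamma>_def)
  qed
  have F: "F \<noteq> bot"
  proof
    assume "F = bot"
    hence "\<rho> \<le> \<rho> - 1" using c by (simp add: asymptotic_center_def)
    thus False by simp
  qed
  define N where "N = (norm w)\<^sup>2"
  have N: "N > 0" using w0[OF F] by (simp add: N_def)
  \<comment> \<open>This step length minimises
    \<open>- \<tau> * \<gamma> + \<tau>\<^sup>2 * N\<close>, a bound on the change of the squared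
    distance. The minimum is \<open>- 2 * e\<close>, which takes \<open>\<rho> + e\<close> to
    \<open>\<rho> - e\<close>.\<close>
  define \<tau> where "\<tau> = \<gamma> / (2 * N)"
  have \<tau>: "\<tau> > 0" using \<gamma> N by (simp add: \<tau>_def)
  define e where "e = \<tau> * \<gamma> / 4"
  have e: "e > 0" using \<tau> \<gamma> by (simp add: e_def)
  have "\<forall>\<^sub>F n in F. (norm (x n - c))\<^sup>2 \<le> \<rho> + e" using c e by (auto simp: asymptotic_center_def)
  moreover have "\<forall>\<^sub>F n in F. inner w (x n) \<le> t + \<gamma> / 2" using \<gamma> by (intro w) simp
  ultimately have "\<forall>\<^sub>F n in F. (norm (x n - (c - \<tau> *\<^sub>R w)))\<^sup>2 \<le> \<rho> - e"
  proof eventually_elim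
    case (elim n)
    have le: "inner w (x n) - inner w c \<le> - (\<gamma> / 2)"
      using elim(2) by (simp add: \<gamma>_def field_simps)
    have "(norm (x n - (c - \<tau> *\<^sub>R w)))\<^sup>2 = (norm (x n - c))\<^sup>2 + 2 * \<tau> * (inner w (x n) - inner w c) + \<tau> * (\<tau> * N)"
      unfolding N_def power2_norm_eq_inner
      by (simp add: inner_simps inner_commute[of "x n" w] inner_commute[of c w] inner_commute[of c "x n"] algebra_simps)
    also have "\<tau> * N = \<gamma> / 2" using N by (simp add: \<tau>_def)
    also have "(norm (x n - c))\<^sup>2 + 2 * \<tau> * (inner w (x n) - inner w c) + \<tau> * (\<gamma> / 2)
        \<le> (\<rho> + e) + 2 * \<tau> * (- (\<gamma> / 2)) + \<tau> * (\<gamma> / 2)"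
      using elim(1) le \<tau> by (intro add_mono mult_left_mono) auto
    also have "\<dots> = \<rho> - e" by (simp add: e_def)
    finally show ?case .
  qed
  hence "\<rho> \<le> \<rho> - e" using c by (auto simp: asymptotic_center_def)
  thus False using e by simp
qed

text \<open>Minty's trick: test the variational inequality at \<open>c - t V(c)\<close> and let \<open>t\<close> tend to 0.\<close>

lemma monotone_zeroI:
  fixes V :: "'a::real_inner \<Rightarrow> 'a"
  assumes cont: "continuous_on UNIV V" and *: "\<And>y. inner (V y) (y - c) \<ge> 0"
  shows "V c = 0"
proof -
  have lim: "((\<lambda>t. inner (V (c + t *\<^sub>R (- V c))) (- V c)) \<longlongrightarrow> inner (V (c + 0 *\<^sub>R (- V c))) (- V c)) (at_right 0)"
  proof (intro tendsto_intros)
    have "isCont V (c + 0 *\<^sub>R (- V c))" using cont by (simp add: continuous_on_eq_continuous_at)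
    moreover have "((\<lambda>t::real. c + t *\<^sub>R (- V c)) \<longlongrightarrow> c + 0 *\<^sub>R (- V c)) (at_right 0)" by (intro tendsto_intros)
    ultimately show "((\<lambda>t. V (c + t *\<^sub>R (- V c))) \<longlongrightarrow> V (c + 0 *\<^sub>R (- V c))) (at_right 0)"
      by (rule isCont_tendsto_compose)
  qed
  have "\<forall>\<^sub>F t in at_right 0. 0 \<le> inner (V (c + t *\<^sub>R (- V c))) (- V c)"
    using eventually_at_right_less[of "0::real"]
  proof eventually_elim
    case (elim t)
    have "0 \<le> t * inner (V (c + t *\<^sub>R (- V c))) (- V c)"
      using *[of "c + t *\<^sub>R (- V c)"] by simp
    thus ?case using elim by (simp only: zero_le_mult_iff) linarith
  qed
  hence "0 \<le> inner (V (c + 0 *\<^sub>R (- V c))) (- V c)"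
    by (intro tendsto_lowerbound[OF lim]) auto
  hence "inner (V c) (V c) \<le> 0" by simp
  thus ?thesis using inner_ge_zero[of "V c"] inner_eq_zero_iff[of "V c"] by linarith
qed

text \<open>Monotonicity bounds \<open>inner (V y) (x n)\<close> by \<open>inner (V y) y\<close>
  plus a term that vanishes because \<open>x\<close> is bounded and \<open>V (x n)\<close> tends to
  0. The half-space lemma passes this to \<open>c\<close>, and Minty's trick finishes.\<close>

lemma asymptotic_center_zero:
  fixes V :: "'a::real_inner \<Rightarrow> 'a"
  assumes V: "monotone_operator V" "continuous_on UNIV V"
    and c: "asymptotic_center x F c \<rho>"
    and bd: "\<And>n. norm (x n) \<le> B" and lim: "((\<lambda>n. V (x n)) \<longlongrightarrow> 0) F"
  shows "V c = 0"
proof (rule monotone_zeroI[OF V(2)])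
  fix y
  have "inner (V y) c \<le> inner (V y) y"
  proof (rule asymptotic_center_halfspace[OF c])
    fix e :: real assume "e > 0"
    have "((\<lambda>n. norm (V (x n)) * (B + norm y)) \<longlongrightarrow> norm (0::'a) * (B + norm y)) F"
      by (intro tendsto_intros lim)
    hence "\<forall>\<^sub>F n in F. norm (V (x n)) * (B + norm y) < e" using \<open>e > 0\<close> by (intro order_tendstoD) auto
    thus "\<forall>\<^sub>F n in F. inner (V y) (x n) \<le> inner (V y) y + e"
    proof eventually_elim
      case (elim n)
      have "inner (V (x n)) (x n - y) \<le> norm (V (x n)) * norm (x n - y)" by (rule norm_cauchy_schwarz)
      also have "\<dots> \<le> norm (V (x n)) * (B + norm y)"
        using bd[of n] norm_triangle_ineq4[of "x n" y] by (intro mult_left_mono) auto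
      finally show ?case
        using elim V(1)[unfolded monotone_operator_def, rule_format, of "x n" y] by (simp add: inner_diff_left inner_diff_right)
    qed
  qed
  thus "0 \<le> inner (V y) (y - c)" by (simp add: inner_diff_right)
qed

text \<open>Opial's argument: the centre \<open>l\<close> of the whole sequence is the only centre
  along any finer proper filter. If a functional failed to converge to its value at
  \<open>l\<close>, the filter of bad indices would have a centre in a half-space that excludes
  \<open>l\<close>.\<close>

lemma weakly_converges_to_zero:
  fixes V :: "'a::{real_inner, complete_space} \<Rightarrow> 'a"
  assumes V: "monotone_operator V" "continuous_on UNIV V"
    and bd: "\<And>n. norm (x n) \<le> B" and lim: "(\<lambda>n. V (x n)) \<longlonglongrightarrow> 0"
    and conv: "\<And>c. V c = 0 \<Longrightarrow> convergent (\<lambda>n. (norm (x n - c))\<^sup>2)"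
  obtains l where "V l = 0" "weakly_converges_to x l"
proof -
  obtain l \<rho>l where l: "asymptotic_center x sequentially l \<rho>l"
    using asymptotic_center_exists[of sequentially x B] bd by auto
  have Vl: "V l = 0" by (rule asymptotic_center_zero[OF V l bd lim])
  obtain a where a: "(\<lambda>n. (norm (x n - l))\<^sup>2) \<longlonglongrightarrow> a" using conv[OF Vl] by (auto simp: convergent_def)
  \<comment> \<open>With \<open>a\<close> and \<open>b\<close> the limits of the squared distances
    to \<open>l\<close> and \<open>c\<close>, the centre properties give
    \<open>a \<le> \<rho>l \<le> b \<le> \<rho>\<close>; so \<open>l\<close> also attains the radius
    along \<open>F\<close>.\<close>
  have center_eq: "c = l" if F: "F \<noteq> bot" "F \<le> sequentially" and c: "asymptotic_center x F c \<rho>" for F c \<rho>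
  proof -
    have Vc: "V c = 0"
      by (rule asymptotic_center_zero[OF V c bd tendsto_mono[OF F(2) lim]])
    obtain b where b: "(\<lambda>n. (norm (x n - c))\<^sup>2) \<longlonglongrightarrow> b" using conv[OF Vc] by (auto simp: convergent_def)
    have "a \<le> \<rho>l + e" if "e > 0" for e
      using l that by (intro tendsto_upperbound[OF a]) (auto simp: asymptotic_center_def)
    hence al: "a \<le> \<rho>l" by (rule field_le_epsilon)
    have "\<rho>l \<le> b + e" if "e > 0" for e
    proof -
      have "\<forall>\<^sub>F n in sequentially. (norm (x n - c))\<^sup>2 < b + e" using that by (intro order_tendstoD[OF b]) auto
      hence "\<forall>\<^sub>F n in sequentially. (norm (x n - c))\<^sup>2 \<le> b + e" by eventually_elim simp
      thus ?thesis using l by (auto simp: asymptotic_center_def)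
    qed
    hence lb: "\<rho>l \<le> b" by (rule field_le_epsilon)
    have "b \<le> \<rho> + e" if "e > 0" for e
      using c that F by (intro tendsto_upperbound[OF tendsto_mono[OF F(2) b]]) (auto simp: asymptotic_center_def)
    hence "b \<le> \<rho>" by (rule field_le_epsilon)
    hence a\<rho>: "a \<le> \<rho>" using al lb by simp
    have "l = c"
    proof (rule asymptotic_center_unique[OF c])
      fix e :: real assume "e > 0"
      hence "\<forall>\<^sub>F n in F. (norm (x n - l))\<^sup>2 < \<rho> + e" using a\<rho> by (intro order_tendstoD[OF tendsto_mono[OF F(2) a]]) auto
      thus "\<forall>\<^sub>F n in F. (norm (x n - l))\<^sup>2 \<le> \<rho> + e" by eventually_elim simp
    qed
    thus ?thesis by simp
  qed
  have ev: "\<forall>\<^sub>F n in sequentially. inner u (x n) < inner u l + e" if "e > 0" for u e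
  proof (rule ccontr)
    assume *: "\<not> ?thesis"
    \<comment> \<open>The bound fails infinitely often, so restricting \<open>sequentially\<close>
      to the bad indices gives a proper filter; it plays the role of a subsequence.\<close>
    define F where "F = inf sequentially (principal {n. inner u l + e \<le> inner u (x n)})"
    have "F \<noteq> bot"
    proof
      assume "F = bot"
      hence "\<forall>\<^sub>F n in F. False" by simp
      hence "\<forall>\<^sub>F n in sequentially. inner u l + e \<le> inner u (x n) \<longrightarrow> False"
        unfolding F_def eventually_inf_principal by simp
      thus False using * by (simp add: not_le)
    qed
    moreover have "F \<le> sequentially" by (simp add: F_def)
    moreover obtain c \<rho> where c: "asymptotic_center x F c \<rho>"
      using asymptotic_center_exists[of F x B] \<open>F \<noteq> bot\<close> bd by auto
    ultimately have "c = l" using center_eq by blast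
    have "inner (- u) c \<le> - (inner u l + e)"
      by (rule asymptotic_center_halfspace[OF c])
         (auto simp: F_def eventually_inf_principal intro!: always_eventually)
    thus False using \<open>c = l\<close> that by simp
  qed
  have "weakly_converges_to x l"
    unfolding weakly_converges_to_def
  proof
    fix u
    show "(\<lambda>k. inner (x k) u) \<longlonglongrightarrow> inner l u"
    proof (rule tendstoI)
      fix e :: real assume "e > 0"
      show "\<forall>\<^sub>F k in sequentially. dist (inner (x k) u) (inner l u) < e"
        using ev[OF \<open>e > 0\<close>, of u] ev[OF \<open>e > 0\<close>, of "- u"]
        by eventually_elim (auto simp: dist_real_def inner_commute abs_less_iff)
    qed
  qed
  with Vl that show ?thesis by blast
qed

section \<open>The discrete energy\<close>

lemma eventually_decreasing:
  fixes a b :: "nat \<Rightarrow> real"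
  assumes dec: "\<forall>\<^sub>F k in sequentially. a (Suc k) \<le> a k - b k"
    and b: "\<And>k. b k \<ge> 0" and lower: "\<forall>\<^sub>F k in sequentially. B \<le> a k"
  shows "convergent a" "summable b"
proof -
  obtain N where N: "\<And>k. k \<ge> N \<Longrightarrow> a (Suc k) \<le> a k - b k" "\<And>k. k \<ge> N \<Longrightarrow> B \<le> a k"
    using eventually_conj[OF dec lower] by (auto simp: eventually_sequentially)
  have "decseq (\<lambda>k. a (k + N))"
    using N(1)[of "_ + N"] b by (intro decseq_SucI) (smt (verit) add_Suc le_add2)
  moreover have "\<forall>i. B \<le> a (i + N)" using N(2) by simp
  ultimately obtain L where "(\<lambda>k. a (k + N)) \<longlonglongrightarrow> L" by (rule decseq_convergent)
  hence L: "a \<longlonglongrightarrow> L" by (rule LIMSEQ_offset)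
  thus "convergent a" by (auto simp: convergent_def)
  have "summable (\<lambda>k. - (a (Suc k) - a k))"
    by (intro summable_minus telescope_summable[OF L])
  thus "summable b"
    by (rule summable_comparison_test'[where N = N]) (use N(1) b in \<open>auto simp: algebra_simps\<close>)
qed

text \<open>Discriminant test with an explicit coercivity constant: \<open>h\<close> satisfies
  \<open>(a - h) * (f - h) = b\<^sup>2 / 4 + h\<^sup>2\<close>, so completing the square still works
  after \<open>h\<close> is subtracted from both diagonal coefficients.\<close>

lemma posdef_form:
  fixes a b f :: real
  assumes "a > 0" "f > 0" "b\<^sup>2 < 4 * a * f"
  obtains h where "h > 0" "\<And>x y :: 'a::real_inner. h * ((norm x)\<^sup>2 + (norm y)\<^sup>2)
     \<le> a * (norm x)\<^sup>2 + b * inner x y + f * (norm y)\<^sup>2"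
proof -
  \<comment> \<open>Determinant over trace of the symmetric matrix of the form, a root-free
    expression below its smaller eigenvalue.\<close>
  define h where "h = (4 * a * f - b\<^sup>2) / (4 * (a + f))"
  have h0: "h > 0" using assms by (simp add: h_def)
  have "4 * (a + f) \<noteq> 0" using assms by simp
  from nonzero_eq_divide_eq[THEN iffD1, OF this h_def]
  have eq: "4 * h * (a + f) = 4 * a * f - b\<^sup>2" by (simp only: ac_simps)
  have "h * (a + f) < a * (a + f)"
  proof -
    have "4 * (h * (a + f)) \<le> 4 * (a * f)" using eq zero_le_power2[of b] by (simp only: mult.assoc)
    thus ?thesis using mult_pos_pos[OF assms(1,1)] by (simp add: distrib_left)
  qed
  hence ha: "h < a" using assms by simp
  have "0 \<le> (a - h) * (a * (norm x)\<^sup>2 + b * inner x y + f * (norm y)\<^sup>2 - h * ((norm x)\<^sup>2 + (norm y)\<^sup>2))" for x y :: 'a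
  proof -
    have "4 * (a - h) * (f - h) = b\<^sup>2 + 4 * h\<^sup>2" using eq by (simp add: algebra_simps power2_eq_square)
    hence e: "(a - h) * (f - h) = b\<^sup>2/4 + h\<^sup>2" by (simp only: mult.assoc)
    have "(a - h) * (a * (norm x)\<^sup>2 + b * inner x y + f * (norm y)\<^sup>2 - h * ((norm x)\<^sup>2 + (norm y)\<^sup>2))
       = (a - h)\<^sup>2 * (norm x)\<^sup>2 + (a - h) * b * inner x y + ((a - h) * (f - h)) * (norm y)\<^sup>2"
      by (simp add: algebra_simps power2_eq_square)
    also have "\<dots> = (norm ((a - h) *\<^sub>R x + (b / 2) *\<^sub>R y))\<^sup>2 + h\<^sup>2 * (norm y)\<^sup>2"
      unfolding e power2_norm_eq_inner
      by (simp add: inner_simps inner_commute[of y x] algebra_simps power2_eq_square)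
    finally show ?thesis by simp
  qed
  hence "h * ((norm x)\<^sup>2 + (norm y)\<^sup>2) \<le> a * (norm x)\<^sup>2 + b * inner x y + f * (norm y)\<^sup>2" for x y :: 'a
    using ha by (simp add: zero_le_mult_iff)
  with h0 that show ?thesis by blast
qed

text \<open>The form is affine in \<open>g\<close>, so positivity at \<open>g = 1/2\<close> and \<open>g = 1\<close> suffices.\<close>

lemma posdef_form_affine:
  fixes A l \<theta> C :: real
  assumes "l < C" "\<theta> > 0"
    and half: "(3 / 4 + \<theta> * (C - 2 * l) / 2)\<^sup>2 < \<theta> * (C - l)"
    and one: "(1 + \<theta> * (C - 2 * l) / 2)\<^sup>2 < 2 * \<theta> * (C - l)"
  obtains h where "h > 0" "\<And>(x :: 'a::real_inner) y g. 1 / 2 \<le> g \<Longrightarrow> g \<le> 1 \<Longrightarrow> h * ((norm x)\<^sup>2 + (norm y)\<^sup>2)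
     \<le> (C - l) * (norm x)\<^sup>2 + ((1 + g) / 2 + \<theta> * (C - 2 * l) / 2) * inner x y + \<theta> * g / 2 * (norm y)\<^sup>2"
proof -
  define Q where "Q g x y = (C - l) * (norm x)\<^sup>2 + ((1 + g) / 2 + \<theta> * (C - 2 * l) / 2) * inner x y + \<theta> * g / 2 * (norm y)\<^sup>2"
    for g and x y :: 'a
  have pos: "0 < C - l" "0 < \<theta> / 4" "0 < \<theta> / 2" using assms by auto
  have "(3 / 4 + \<theta> * (C - 2 * l) / 2)\<^sup>2 < 4 * (C - l) * (\<theta> / 4)"
  proof -
    have "4 * (C - l) * (\<theta> / 4) = \<theta> * (C - l)" by (simp add: algebra_simps)
    thus ?thesis using half by (simp only:)
  qed
  from posdef_form[OF pos(1,2) this, where 'a = 'a]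
  obtain h1 where h1: "h1 > 0" "\<And>x y. h1 * ((norm x)\<^sup>2 + (norm y)\<^sup>2) \<le> Q (1/2) x y"
    unfolding Q_def by auto
  have "(1 + \<theta> * (C - 2 * l) / 2)\<^sup>2 < 4 * (C - l) * (\<theta> / 2)" using one by (simp add: algebra_simps)
  from posdef_form[OF pos(1,3) this, where 'a = 'a]
  obtain h2 where h2: "h2 > 0" "\<And>x y. h2 * ((norm x)\<^sup>2 + (norm y)\<^sup>2) \<le> Q 1 x y"
    unfolding Q_def by auto
  define h where "h = min h1 h2"
  have "h * ((norm x)\<^sup>2 + (norm y)\<^sup>2) \<le> Q g x y" if g: "1 / 2 \<le> g" "g \<le> 1" for g x y
  proof -
    define S where "S = (norm x)\<^sup>2 + (norm y)\<^sup>2"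
    have S: "S \<ge> 0" by (simp add: S_def)
    have 1: "h * S \<le> Q (1/2) x y" using h1(2)[of x y] mult_right_mono[OF min.cobounded1[of h1 h2] S] by (simp add: h_def S_def)
    have 2: "h * S \<le> Q 1 x y" using h2(2)[of x y] mult_right_mono[OF min.cobounded2[of h1 h2] S] by (simp add: h_def S_def)
    have "h * S = (2 - 2 * g) * (h * S) + (2 * g - 1) * (h * S)" by (simp add: algebra_simps)
    also have "\<dots> \<le> (2 - 2 * g) * Q (1/2) x y + (2 * g - 1) * Q 1 x y"
      using 1 2 g by (intro add_mono mult_left_mono) auto
    also have "\<dots> = Q g x y" by (simp add: Q_def field_simps)
    finally show ?thesis by (simp add: S_def)
  qed
  thus ?thesis using h1(1) h2(1) by (intro that[of h]) (auto simp: h_def Q_def)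
qed

text \<open>
  The slack in the inequality is \<open>s' m/2 \<langle>W - U, v\<rangle>\<close> plus two squares that come from the implicit
  discretisation; only the monotonicity term needs a hypothesis.
\<close>

lemma energy_step:
  fixes d v W U q p :: "'a::real_inner" and b c c' m m' s' l :: real
  assumes q: "q = s' *\<^sub>R v + m' *\<^sub>R W" and p: "p = q + c *\<^sub>R v + b *\<^sub>R W"
    and mon: "inner (W - U) v \<ge> 0" and "s' \<ge> 0" "m \<ge> 0"
  shows "l * (c' / 2 * (norm d)\<^sup>2 + inner d q)
      + ((norm (q - (m' / 2) *\<^sub>R W))\<^sup>2 / 2 + (norm (m' *\<^sub>R W))\<^sup>2 / 8)
    \<le> l * (c / 2 * (norm (d - v))\<^sup>2 + inner (d - v) p)
      + ((norm (p - (m / 2) *\<^sub>R U))\<^sup>2 / 2 + (norm (m *\<^sub>R U))\<^sup>2 / 8)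
      + l / 2 * (c' - c) * (norm d)\<^sup>2 - l * b * inner d W
      - ((s' * (c - l) - l * c / 2) * (norm v)\<^sup>2
        + (b * s' + c * m' / 2 + s' * (m' - m) / 2 - l * (m' + b)) * inner v W
        + m' * b / 2 * (norm W)\<^sup>2)"
proof -
  \<comment> \<open>\<open>D\<close> is the drop in momentum \<open>p - q\<close> and
    \<open>N\<close> the increment of \<open>m V(z)\<close>. In these variables the leftover
    quadratic terms are squares, of \<open>D + N\<close> and of \<open>D\<close>.\<close>
  define D where "D = c *\<^sub>R v + b *\<^sub>R W"
  define M' where "M' = m' *\<^sub>R W"
  define N where "N = M' - m *\<^sub>R U"
  have half: "(m' / 2) *\<^sub>R W = (1/2) *\<^sub>R M'" "(m / 2) *\<^sub>R U = (1/2) *\<^sub>R (M' - N)" "m *\<^sub>R U = M' - N"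
    by (simp_all add: M'_def N_def)
  have pq: "p = q + D" by (simp add: p D_def)
  have A: "((norm (q + D - (1/2) *\<^sub>R (M' - N)))\<^sup>2 / 2 + (norm (M' - N))\<^sup>2 / 8)
      = ((norm (q - (1/2) *\<^sub>R M'))\<^sup>2 / 2 + (norm M')\<^sup>2 / 8)
        + inner (q - (1/2) *\<^sub>R M') D + inner (q - M') N / 2 + (norm (D + N))\<^sup>2 / 4 + (norm D)\<^sup>2 / 4"
    unfolding power2_norm_eq_inner
    by (simp add: inner_simps inner_commute[of D q] inner_commute[of M' q] inner_commute[of N q] inner_commute[of M' D] inner_commute[of N D] inner_commute[of N M'] field_simps)
  have B: "c / 2 * (norm (d - v))\<^sup>2 + inner (d - v) p
      = c / 2 * (norm d)\<^sup>2 + inner d q + b * inner d W - c / 2 * (norm v)\<^sup>2 - inner v q - b * inner v W"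
    unfolding power2_norm_eq_inner pq D_def
    by (simp add: inner_simps inner_commute[of v d] field_simps)
  have C: "inner (q - (1/2) *\<^sub>R M') D
      = s' * c * (norm v)\<^sup>2 + (s' * b + m' * c / 2) * inner v W + m' * b / 2 * (norm W)\<^sup>2"
    unfolding power2_norm_eq_inner q D_def M'_def
    by (simp add: inner_simps inner_commute[of W v] field_simps)
  have E: "inner (q - M') N = s' * ((m' - m) * inner v W + m * inner (W - U) v)"
    unfolding q N_def M'_def
    by (simp add: inner_simps inner_commute[of W v] inner_commute[of U v] algebra_simps)
  have G: "inner v q = s' * (norm v)\<^sup>2 + m' * inner v W"
    unfolding power2_norm_eq_inner q by (simp add: inner_simps)
  have "0 \<le> s' * (m * inner (W - U) v) / 2 + (norm (D + N))\<^sup>2 / 4 + (norm D)\<^sup>2 / 4"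
    using assms by simp
  thus ?thesis
    unfolding half B unfolding pq A C E G by (simp only: M'_def[symmetric]) (simp add: algebra_simps add_divide_distrib diff_divide_distrib)
qed

section \<open>Abstract form of the implicit scheme\<close>

locale implicit_iterates =
  fixes V :: "'a::real_inner \<Rightarrow> 'a" and z :: "nat \<Rightarrow> 'a"
    and s \<beta> :: "nat \<Rightarrow> real" and \<theta> :: real
begin

text \<open>These notions live in a locale without assumptions because the hypotheses of
  \<open>implicit_scheme\<close> refer to them.\<close>

definition m :: "nat \<Rightarrow> real" where
  "m k = \<theta> * (s k)\<^sup>2 * \<beta> (k - 1)"

definition vel :: "nat \<Rightarrow> 'a" where
  "vel k = z k - z (k - 1)"

definition mom :: "nat \<Rightarrow> 'a" where
  "mom k = s k *\<^sub>R vel k + m k *\<^sub>R V (z k)"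

end

text \<open>
  In the application \<open>s k = k powr r\<close>, \<open>c k = \<alpha> - r k powr (r - 1)\<close>,
  \<open>g k = 1 - \<theta> k powr r ((\<beta>\<^sub>k - \<beta>\<^sub>k\<^sub>-\<^sub>1) / \<beta>\<^sub>k + 2 r / k)\<close>, and \<open>e k\<close> is the first-order Taylor remainder
  of \<open>x powr (2 r)\<close> between \<open>k\<close> and \<open>k + 1\<close>. The limit \<open>C\<close> of \<open>c\<close> is \<open>\<alpha>\<close> for \<open>r < 1\<close> and \<open>\<alpha> - 1\<close> for \<open>r = 1\<close>.
\<close>

locale implicit_scheme = implicit_iterates V z s \<beta> \<theta>
  for V :: "'a::real_inner \<Rightarrow> 'a" and z s \<beta> \<theta> +
  fixes c g e :: "nat \<Rightarrow> real" and C :: real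
  assumes V: "monotone_operator V"
    and \<theta>: "\<theta> > 0" and C: "9 / 8 < \<theta> * C"
    and s_pos: "\<And>k. k \<ge> 1 \<Longrightarrow> s k > 0" and \<beta>_pos: "\<And>k. \<beta> k > 0"
    and step: "\<And>k. k \<ge> 1 \<Longrightarrow>
      mom k = mom (k + 1) + c k *\<^sub>R vel (k + 1) + (s k * \<beta> k * g k) *\<^sub>R V (z (k + 1))"
    and m_step: "\<And>k. k \<ge> 1 \<Longrightarrow> m (k + 1) - m k = s k * \<beta> k * (1 - g k) + \<theta> * \<beta> k * e k"
    and g: "\<forall>\<^sub>F k in sequentially. 1 / 2 \<le> g k \<and> g k \<le> 1"
    and c_lim: "c \<longlonglongrightarrow> C"
    and s_lim: "filterlim s at_top sequentially"
    and s_ratio: "(\<lambda>k. s k / s (k + 1)) \<longlonglongrightarrow> 1"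
    and e_lim: "(\<lambda>k. e k / s (k + 1)) \<longlonglongrightarrow> 0"
    and s_div: "\<not> summable (\<lambda>k. 1 / s k)"
begin

section \<open>Decrease and coercivity of the energies\<close>

definition Phi :: "'a \<Rightarrow> nat \<Rightarrow> real" where
  "Phi a k = c k / 2 * (norm (z k - a))\<^sup>2 + inner (z k - a) (mom k)"

definition Psi :: "nat \<Rightarrow> real" where
  "Psi k = (norm (mom k - (m k / 2) *\<^sub>R V (z k)))\<^sup>2 / 2 + (norm (m k *\<^sub>R V (z k)))\<^sup>2 / 8"

definition dissip :: "nat \<Rightarrow> real" where
  "dissip k = s (k + 1) * ((norm (vel (k + 1)))\<^sup>2 + (norm ((s (k + 1) * \<beta> k) *\<^sub>R V (z (k + 1))))\<^sup>2)"

lemma dissip_nonneg: "dissip k \<ge> 0"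
  using s_pos[of "k + 1"] by (simp add: dissip_def)

lemma m_nonneg: "m k \<ge> 0"
  using \<theta> \<beta>_pos[of "k - 1"] by (simp add: m_def)

lemma zero_monotone: "V a = 0 \<Longrightarrow> 0 \<le> inner (z k - a) (V (z k))"
  using V[unfolded monotone_operator_def, rule_format, of "z k" a] by (simp add: inner_commute)

text \<open>Dividing the form in \<open>energy_step\<close> by \<open>s (k + 1)\<close> and
  rescaling \<open>V (z (k + 1))\<close> gives coefficients that approach those of
  \<open>posdef_form_affine\<close> at \<open>g k\<close>. Hence half of the coercivity constant
  survives for large \<open>k\<close>.\<close>

lemma energy_decrease:
  assumes l: "0 < l" "l < C"
    and half: "(3 / 4 + \<theta> * (C - 2 * l) / 2)\<^sup>2 < \<theta> * (C - l)"
    and one: "(1 + \<theta> * (C - 2 * l) / 2)\<^sup>2 < 2 * \<theta> * (C - l)"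
  obtains \<eta> where "\<eta> > 0"
    "\<And>a. V a = 0 \<Longrightarrow> \<forall>\<^sub>F k in sequentially. l * Phi a (k + 1) + Psi (k + 1)
       \<le> l * Phi a k + Psi k + l / 2 * (c (k + 1) - c k) * (norm (z (k + 1) - a))\<^sup>2 - \<eta> * dissip k"
proof -
  obtain h where h: "h > 0" "\<And>(x :: 'a::real_inner) y g. 1 / 2 \<le> g \<Longrightarrow> g \<le> 1 \<Longrightarrow> h * ((norm x)\<^sup>2 + (norm y)\<^sup>2)
     \<le> (C - l) * (norm x)\<^sup>2 + ((1 + g) / 2 + \<theta> * (C - 2 * l) / 2) * inner x y + \<theta> * g / 2 * (norm y)\<^sup>2"
    using posdef_form_affine[OF l(2) \<theta> half one] by metis
  define \<rho> where "\<rho> k = s k / s (k + 1)" for k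
  define err where "err k = (1 + \<theta>) * \<bar>\<rho> k - 1\<bar> + (1 + \<theta>) * \<bar>c k - C\<bar> + \<theta> * \<bar>e k / s (k + 1)\<bar>
      + l * \<bar>\<rho> k\<bar> * inverse (s (k + 1)) + l * \<bar>c k\<bar> * inverse (s (k + 1))" for k
  have inv0: "(\<lambda>k. inverse (s (k + 1))) \<longlonglongrightarrow> 0"
    by (rule LIMSEQ_ignore_initial_segment[OF tendsto_inverse_0_at_top[OF s_lim]])
  have "err \<longlonglongrightarrow> (1 + \<theta>) * \<bar>1 - 1\<bar> + (1 + \<theta>) * \<bar>C - C\<bar> + \<theta> * \<bar>0\<bar> + l * \<bar>1\<bar> * 0 + l * \<bar>C\<bar> * 0"
    unfolding err_def \<rho>_def by (intro tendsto_intros s_ratio c_lim e_lim inv0)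
  hence err: "\<forall>\<^sub>F k in sequentially. err k < h / 4" using h(1) by (intro order_tendstoD) auto
  show ?thesis
  proof (rule that[of "h / 2"])
    show "h / 2 > 0" using h by simp
    fix a assume a: "V a = 0"
    show "\<forall>\<^sub>F k in sequentially. l * Phi a (k + 1) + Psi (k + 1)
       \<le> l * Phi a k + Psi k + l / 2 * (c (k + 1) - c k) * (norm (z (k + 1) - a))\<^sup>2 - h / 2 * dissip k"
      using err g eventually_ge_at_top[of 1]
    proof eventually_elim
      case (elim k)
      define x where "x = vel (k + 1)"
      define W where "W = V (z (k + 1))"
      define y where "y = (s (k + 1) * \<beta> k) *\<^sub>R W"
      define b where "b = s k * \<beta> k * g k"
      have s: "s k > 0" "s (k + 1) > 0" using s_pos elim(3) by auto
      have \<beta>: "\<beta> k > 0" by (rule \<beta>_pos)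
      have b0: "b \<ge> 0" using s \<beta> elim(2) by (simp add: b_def)
      have zk: "z (k + 1) - a - vel (k + 1) = z k - a" by (simp add: vel_def)
      have "inner (V (z (k + 1)) - V (z k)) (vel (k + 1)) \<ge> 0"
        using V by (simp add: monotone_operator_def vel_def)
      from energy_step[OF mom_def[of "k + 1"] step[OF elim(3)] this less_imp_le[OF s(2)] m_nonneg, of l "c (k + 1)" "z (k + 1) - a", unfolded zk]
      have main: "l * Phi a (k + 1) + Psi (k + 1)
       \<le> l * Phi a k + Psi k + l / 2 * (c (k + 1) - c k) * (norm (z (k + 1) - a))\<^sup>2 
         - l * b * inner (z (k + 1) - a) W
         - ((s (k + 1) * (c k - l) - l * c k / 2) * (norm x)\<^sup>2
            + (b * s (k + 1) + c k * m (k + 1) / 2 + s (k + 1) * (m (k + 1) - m k) / 2 - l * (m (k + 1) + b)) * inner x W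
            + m (k + 1) * b / 2 * (norm W)\<^sup>2)"
        unfolding Phi_def Psi_def x_def W_def b_def .
      have "0 \<le> l * b * inner (z (k + 1) - a) W"
        using l b0 zero_monotone[OF a] by (simp add: W_def)
      moreover have "h / 2 * dissip k \<le> (s (k + 1) * (c k - l) - l * c k / 2) * (norm x)\<^sup>2
            + (b * s (k + 1) + c k * m (k + 1) / 2 + s (k + 1) * (m (k + 1) - m k) / 2 - l * (m (k + 1) + b)) * inner x W
            + m (k + 1) * b / 2 * (norm W)\<^sup>2"
      proof -
        \<comment> \<open>\<open>A\<close>, \<open>B\<close> and \<open>F\<close> are the normalised
          coefficients. In \<open>B\<close>, up to the factor \<open>\<rho> k\<close>, the part
          \<open>(1 + g k) / 2\<close> is \<open>g k\<close> from \<open>b * s (k + 1)\<close> plus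
          \<open>(1 - g k) / 2\<close> from half the increment of \<open>m\<close>.\<close>
        define A where "A = c k - l - l * c k / 2 * inverse (s (k + 1))"
        define B where "B = (1 + g k) / 2 * \<rho> k + c k * \<theta> / 2 - l * \<theta> + \<theta> / 2 * (e k / s (k + 1)) - l * \<rho> k * g k * inverse (s (k + 1))"
        define F where "F = \<theta> * \<rho> k * g k / 2"
        define S where "S = (norm x)\<^sup>2 + (norm y)\<^sup>2"
        have eA: "s (k + 1) * A = s (k + 1) * (c k - l) - l * c k / 2"
          using s by (simp add: A_def field_simps)
        have m': "m (k + 1) = \<theta> * (s (k + 1))\<^sup>2 * \<beta> k" by (simp add: m_def)
        have \<rho>s: "\<rho> k * s (k + 1) = s k" using s by (simp add: \<rho>_def)
        have eB: "s (k + 1) * B * (s (k + 1) * \<beta> k) = b * s (k + 1) + c k * m (k + 1) / 2 + s (k + 1) * (m (k + 1) - m k) / 2 - l * (m (k + 1) + b)"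
          unfolding m_step[OF elim(3)] unfolding m' b_def \<rho>s[symmetric] B_def using s
          by (simp add: field_simps power2_eq_square)
        have eF: "s (k + 1) * F * (s (k + 1) * \<beta> k)\<^sup>2 = m (k + 1) * b / 2"
          unfolding m' b_def F_def \<rho>s[symmetric] by (simp add: power2_eq_square)
        define P1 where "P1 = \<bar>\<rho> k - 1\<bar>"
        define P2 where "P2 = \<bar>c k - C\<bar>"
        define P3 where "P3 = \<bar>e k / s (k + 1)\<bar>"
        define P4 where "P4 = l * \<bar>\<rho> k\<bar> * inverse (s (k + 1))"
        define P5 where "P5 = l * \<bar>c k\<bar> * inverse (s (k + 1))"
        have err_eq: "err k = P1 + \<theta> * P1 + P2 + \<theta> * P2 + \<theta> * P3 + P4 + P5"
          by (simp add: err_def P1_def P2_def P3_def P4_def P5_def distrib_right)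
        have nn: "0 \<le> P1" "0 \<le> \<theta> * P1" "0 \<le> P2" "0 \<le> \<theta> * P2" "0 \<le> \<theta> * P3" "0 \<le> P4" "0 \<le> P5"
          using l s \<theta> by (auto simp: P1_def P2_def P3_def P4_def P5_def)
        have "\<bar>A - (C - l)\<bar> \<le> err k"
        proof -
          have "A - (C - l) = (c k - C) - l * c k / 2 * inverse (s (k + 1))" by (simp add: A_def)
          moreover have "\<bar>l * c k / 2 * inverse (s (k + 1))\<bar> \<le> P5"
            using l s by (simp add: abs_mult P5_def)
          ultimately have "\<bar>A - (C - l)\<bar> \<le> P2 + P5" unfolding P2_def by linarith
          thus ?thesis using nn err_eq by linarith
        qed
        moreover have "\<bar>B - ((1 + g k) / 2 + \<theta> * (C - 2 * l) / 2)\<bar> \<le> err k"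
        proof -
          have "B - ((1 + g k) / 2 + \<theta> * (C - 2 * l) / 2) 
             = (1 + g k) / 2 * (\<rho> k - 1) + \<theta> / 2 * (c k - C) + \<theta> / 2 * (e k / s (k + 1)) - g k * (l * \<rho> k * inverse (s (k + 1)))"
            by (simp add: B_def algebra_simps diff_divide_distrib add_divide_distrib)
          moreover have "\<bar>(1 + g k) / 2 * (\<rho> k - 1)\<bar> \<le> 1 * P1"
            unfolding abs_mult P1_def using elim(2) by (intro mult_right_mono) auto
          moreover have "\<bar>\<theta> / 2 * (c k - C)\<bar> \<le> \<theta> * P2"
            unfolding abs_mult P2_def using \<theta> by (intro mult_right_mono) auto
          moreover have "\<bar>\<theta> / 2 * (e k / s (k + 1))\<bar> \<le> \<theta> * P3"
            unfolding abs_mult P3_def using \<theta> by (intro mult_right_mono) auto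
          moreover have "\<bar>g k * (l * \<rho> k * inverse (s (k + 1)))\<bar> \<le> 1 * \<bar>l * \<rho> k * inverse (s (k + 1))\<bar>"
            unfolding abs_mult[of "g k"] using elim(2) by (intro mult_right_mono) auto
          moreover have "\<bar>l * \<rho> k * inverse (s (k + 1))\<bar> = P4"
            using l s by (simp add: abs_mult P4_def)
          ultimately have "\<bar>B - ((1 + g k) / 2 + \<theta> * (C - 2 * l) / 2)\<bar> \<le> P1 + \<theta> * P2 + \<theta> * P3 + P4"
            by linarith
          thus ?thesis using nn err_eq by linarith
        qed
        moreover have "\<bar>F - \<theta> * g k / 2\<bar> \<le> err k"
        proof -
          have "F - \<theta> * g k / 2 = \<theta> * g k / 2 * (\<rho> k - 1)" by (simp add: F_def algebra_simps)
          also have "\<bar>\<dots>\<bar> \<le> \<theta> * P1"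
            unfolding abs_mult[of _ "\<rho> k - 1"] P1_def using elim(2) \<theta>
            by (intro mult_right_mono) (auto simp: abs_mult)
          finally show ?thesis using nn err_eq by linarith
        qed
        ultimately have bnd: "\<bar>A - (C - l)\<bar> \<le> h / 4" "\<bar>B - ((1 + g k) / 2 + \<theta> * (C - 2 * l) / 2)\<bar> \<le> h / 4"
          "\<bar>F - \<theta> * g k / 2\<bar> \<le> h / 4" using elim(1) by linarith+
        \<comment> \<open>Coefficient errors of at most \<open>h / 4\<close> cost
          \<open>h / 4 * S\<close> on the squares and, by this bound, \<open>h / 4 * S\<close> on
          the cross term, which leaves \<open>h / 2 * S\<close>.\<close>
        have ixy: "\<bar>inner x y\<bar> \<le> S"
          using Cauchy_Schwarz_ineq2[of x y] sum_squares_bound[of "norm x" "norm y"] unfolding S_def by auto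
        have "(A - (C - l)) * (norm x)\<^sup>2 \<ge> - (h / 4) * (norm x)\<^sup>2"
          using abs_le_D2[OF bnd(1)] by (intro mult_right_mono zero_le_power2) linarith
        moreover have "(F - \<theta> * g k / 2) * (norm y)\<^sup>2 \<ge> - (h / 4) * (norm y)\<^sup>2"
          using abs_le_D2[OF bnd(3)] by (intro mult_right_mono zero_le_power2) linarith
        moreover have "\<bar>(B - ((1 + g k) / 2 + \<theta> * (C - 2 * l) / 2)) * inner x y\<bar> \<le> h / 4 * S"
          unfolding abs_mult using bnd(2) ixy h(1) by (intro mult_mono) auto
        moreover have "h * S \<le> (C - l) * (norm x)\<^sup>2 + ((1 + g k) / 2 + \<theta> * (C - 2 * l) / 2) * inner x y + \<theta> * g k / 2 * (norm y)\<^sup>2"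
          unfolding S_def using elim(2) by (intro h(2)) auto
        moreover have "h / 4 * S = h / 4 * (norm x)\<^sup>2 + h / 4 * (norm y)\<^sup>2" by (simp add: S_def algebra_simps)
        ultimately have "h / 2 * S \<le> A * (norm x)\<^sup>2 + B * inner x y + F * (norm y)\<^sup>2"
          unfolding left_diff_distrib by linarith
        hence "s (k + 1) * (h / 2 * S) \<le> s (k + 1) * (A * (norm x)\<^sup>2 + B * inner x y + F * (norm y)\<^sup>2)"
          using s by simp
        also have "\<dots> = (s (k + 1) * A) * (norm x)\<^sup>2 + (s (k + 1) * B * (s (k + 1) * \<beta> k)) * inner x W
            + (s (k + 1) * F * (s (k + 1) * \<beta> k)\<^sup>2) * (norm W)\<^sup>2"
          by (simp add: y_def power_mult_distrib algebra_simps)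
        finally show ?thesis unfolding eA eB eF
          by (simp add: dissip_def S_def x_def y_def W_def mult_ac)
      qed
      ultimately show ?case using main by linarith
    qed
  qed
qed

text \<open>Completing the square with \<open>l *\<^sub>R d + X\<close> leaves a distance term with
  coefficient \<open>l * (c k - l) / 2\<close> and the pairing \<open>l / 2 * inner d M\<close>,
  nonnegative by monotonicity at the zero \<open>a\<close>.\<close>

lemma energy_lower_bound:
  assumes l: "0 < l" "l < C" and a: "V a = 0"
  shows "\<forall>\<^sub>F k in sequentially. l * (C - l) / 4 * (norm (z k - a))\<^sup>2 \<le> l * Phi a k + Psi k"
proof -
  have "\<forall>\<^sub>F k in sequentially. (C + l) / 2 < c k"
    using l by (intro order_tendstoD[OF c_lim]) simp
  thus ?thesis
  proof eventually_elim
    case (elim k)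
    define d where "d = z k - a"
    define M where "M = m k *\<^sub>R V (z k)"
    define X where "X = mom k - (1 / 2) *\<^sub>R M"
    have "l * Phi a k + Psi k = (norm (l *\<^sub>R d + X))\<^sup>2 / 2 + (norm M)\<^sup>2 / 8
        + l * (c k - l) / 2 * (norm d)\<^sup>2 + l / 2 * inner d M"
    proof -
      have mom: "mom k = X + (1 / 2) *\<^sub>R M" and M2: "(m k / 2) *\<^sub>R V (z k) = (1 / 2) *\<^sub>R M"
        by (simp_all add: X_def M_def)
      show ?thesis
        unfolding Phi_def Psi_def M2 mom power2_norm_eq_inner unfolding d_def[symmetric] M_def[symmetric]
        by (simp add: inner_simps inner_commute[of X d] algebra_simps add_divide_distrib diff_divide_distrib)
    qed
    moreover have "0 \<le> l / 2 * inner d M"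
      using l m_nonneg[of k] zero_monotone[OF a] by (simp add: M_def d_def)
    moreover have "l * (C - l) / 4 * (norm d)\<^sup>2 \<le> l * (c k - l) / 2 * (norm d)\<^sup>2"
    proof (intro mult_right_mono)
      have "l * ((C - l) / 4) \<le> l * ((c k - l) / 2)" using elim l by (intro mult_left_mono) (auto simp: field_simps)
      thus "l * (C - l) / 4 \<le> l * (c k - l) / 2" by simp
    qed auto
    ultimately show ?case unfolding d_def
      using zero_le_power2[of "norm (l *\<^sub>R d + X)"] zero_le_power2[of "norm M"] unfolding d_def by linarith
  qed
qed

section \<open>From summable dissipation to limits\<close>

lemma mom_minus_half: "mom k - (m k / 2) *\<^sub>R V (z k) = s k *\<^sub>R vel k + (1 / 2) *\<^sub>R (m k *\<^sub>R V (z k))"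
proof -
  have "m k *\<^sub>R V (z k) - (m k / 2) *\<^sub>R V (z k) = (m k / 2) *\<^sub>R V (z k)"
    unfolding scaleR_left_diff_distrib[symmetric] by simp
  thus ?thesis by (simp add: mom_def add_diff_eq[symmetric])
qed

text \<open>The parallelogram law removes the cross term in \<open>Psi\<close>. The extra factor
  \<open>s (k + 1)\<close> is why divergence of the sum of \<open>1 / s k\<close> is needed to force
  \<open>Psi\<close> to 0.\<close>

lemma Psi_le_dissip: "Psi (k + 1) \<le> (1 + \<theta>\<^sup>2) * (s (k + 1) * dissip k)"
proof -
  define X where "X = s (k + 1) *\<^sub>R vel (k + 1)"
  define M where "M = m (k + 1) *\<^sub>R V (z (k + 1))"
  define Y where "Y = (s (k + 1) * \<beta> k) *\<^sub>R V (z (k + 1))"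
  have M: "M = (\<theta> * s (k + 1)) *\<^sub>R Y"
    by (simp add: M_def Y_def m_def power2_eq_square mult_ac)
  have "Psi (k + 1) = (norm (X + (1 / 2) *\<^sub>R M))\<^sup>2 / 2 + (norm M)\<^sup>2 / 8"
    unfolding Psi_def mom_minus_half X_def M_def ..
  also have "(norm (X + (1 / 2) *\<^sub>R M))\<^sup>2 + (norm (X - (1 / 2) *\<^sub>R M))\<^sup>2 = 2 * (norm X)\<^sup>2 + (norm M)\<^sup>2 / 2"
    unfolding power2_norm_eq_inner by (simp add: inner_simps inner_commute[of M X] algebra_simps)
  hence "(norm (X + (1 / 2) *\<^sub>R M))\<^sup>2 / 2 + (norm M)\<^sup>2 / 8 \<le> (norm X)\<^sup>2 + (norm M)\<^sup>2"
    using zero_le_power2[of "norm (X - (1 / 2) *\<^sub>R M)"] zero_le_power2[of "norm M"] by linarith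
  also have "\<dots> = (s (k + 1))\<^sup>2 * ((norm (vel (k + 1)))\<^sup>2 + \<theta>\<^sup>2 * (norm Y)\<^sup>2)"
    by (simp add: M X_def power_mult_distrib algebra_simps)
  also have "\<dots> \<le> (s (k + 1))\<^sup>2 * ((1 + \<theta>\<^sup>2) * ((norm (vel (k + 1)))\<^sup>2 + (norm Y)\<^sup>2))"
    by (intro mult_left_mono) (auto simp: algebra_simps)
  also have "\<dots> = (1 + \<theta>\<^sup>2) * (s (k + 1) * dissip k)"
    by (simp add: dissip_def Y_def power2_eq_square)
  finally show ?thesis .
qed

text \<open>\<open>K\<close> replaces the squared distances in the drift of \<open>c\<close> by a
  constant. The drift then telescopes and is absorbed by subtracting a multiple of
  \<open>c k\<close>, which converges.\<close>

lemma energy_limits: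
  assumes a: "V a = 0"
    and K: "\<And>k. k \<ge> 1 \<Longrightarrow> (c (k + 1) - c k) * (norm (z (k + 1) - a))\<^sup>2 \<le> K * (c (k + 1) - c k)"
  shows "convergent (Phi a)" "Psi \<longlonglongrightarrow> 0" "\<exists>B. \<forall>k. norm (z k - a) \<le> B"
proof -
  have energy: "convergent (\<lambda>k. l * Phi a k + Psi k) \<and> summable dissip"
    if l: "0 < l" "l < C" and half: "(3 / 4 + \<theta> * (C - 2 * l) / 2)\<^sup>2 < \<theta> * (C - l)"
    and one: "(1 + \<theta> * (C - 2 * l) / 2)\<^sup>2 < 2 * \<theta> * (C - l)" for l
  proof -
    obtain \<eta> where \<eta>: "\<eta> > 0" "\<forall>\<^sub>F k in sequentially. l * Phi a (k + 1) + Psi (k + 1)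
       \<le> l * Phi a k + Psi k + l / 2 * (c (k + 1) - c k) * (norm (z (k + 1) - a))\<^sup>2 - \<eta> * dissip k"
      by (rule energy_decrease[OF l half one]) (use a in blast)
    define L where "L k = l * Phi a k + Psi k - l / 2 * K * c k" for k
    obtain Bc where Bc: "\<And>k. norm (c k) \<le> Bc"
      using convergent_imp_Bseq[OF convergentI[OF c_lim]] by (auto simp: Bseq_def)
    have dec: "\<forall>\<^sub>F k in sequentially. L (Suc k) \<le> L k - \<eta> * dissip k"
      using \<eta>(2) eventually_ge_at_top[of 1]
    proof eventually_elim
      case (elim k)
      have "l / 2 * ((c (k + 1) - c k) * (norm (z (k + 1) - a))\<^sup>2) \<le> l / 2 * (K * (c (k + 1) - c k))"
        using K[OF elim(2)] l by (intro mult_left_mono) auto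
      thus ?case using elim(1) by (simp add: L_def algebra_simps)
    qed
    have low: "\<forall>\<^sub>F k in sequentially. - (l / 2 * \<bar>K\<bar> * Bc) \<le> L k"
      using energy_lower_bound[OF l a]
    proof eventually_elim
      case (elim k)
      have "0 \<le> l * (C - l) / 4 * (norm (z k - a))\<^sup>2" using l by simp
      moreover have "\<bar>l / 2 * K * c k\<bar> \<le> l / 2 * \<bar>K\<bar> * Bc"
        using Bc[of k] l by (simp add: abs_mult mult_left_mono)
      ultimately show ?case using elim by (simp add: L_def)
    qed
    have "convergent L" "summable (\<lambda>k. \<eta> * dissip k)"
      using eventually_decreasing[OF dec _ low] dissip_nonneg \<eta>(1) by auto
    moreover have "convergent (\<lambda>k. l / 2 * K * c k)"
      by (intro convergentI[of _ "l / 2 * K * C"] tendsto_intros c_lim)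
    ultimately have "convergent (\<lambda>k. L k + l / 2 * K * c k)" "summable dissip"
      using \<eta>(1) by (auto intro!: convergent_add simp del: convergent_add_const_iff)
    thus ?thesis by (simp add: L_def)
  qed
  \<comment> \<open>The energy is affine in \<open>l\<close>, so two admissible values of \<open>l\<close> separate \<open>Phi\<close> from \<open>Psi\<close>.\<close>
  define l1 where "l1 = C / 2"
  define l2 where "l2 = C / 2 + 1 / (4 * \<theta>)"
  have Cpos: "C > 0" using C \<theta> by (smt (verit) mult_nonneg_nonpos divide_nonneg_nonneg)
  have \<theta>l2: "\<theta> * (C - 2 * l2) = - 1 / 2" "\<theta> * (C - l2) = \<theta> * C / 2 - 1 / 4"
    using \<theta> by (auto simp: l2_def field_simps)
  have \<theta>l1: "\<theta> * (C - 2 * l1) = 0" "\<theta> * (C - l1) = \<theta> * C / 2"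
    by (auto simp: l1_def field_simps)
  have l1: "0 < l1" "l1 < C" using Cpos by (auto simp: l1_def)
  have "0 < \<theta> * (C - l2)" using C \<theta>l2 by simp
  hence l2: "0 < l2" "l2 < C" using Cpos \<theta> by (auto simp: l2_def zero_less_mult_iff add_pos_pos)
  \<comment> \<open>At \<open>l1\<close> the admissibility conditions read
    \<open>9 / 16 < \<theta> * C / 2\<close> and \<open>1 < \<theta> * C\<close>; the first is
    exactly the bound \<open>9 / 8 < \<theta> * C\<close>.\<close>
  have E1: "convergent (\<lambda>k. l1 * Phi a k + Psi k)" "summable dissip"
    using energy[OF l1] C unfolding mult.assoc[of 2 \<theta>] \<theta>l1 by (auto simp: power2_eq_square)
  \<comment> \<open>At \<open>l2\<close> they amount to \<open>1 < \<theta> * C\<close> and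
    \<open>17 / 16 < \<theta> * C\<close>.\<close>
  have E2: "convergent (\<lambda>k. l2 * Phi a k + Psi k)"
    using energy[OF l2] C unfolding mult.assoc[of 2 \<theta>] \<theta>l2 by (auto simp: power2_eq_square mult.commute[of C])
  have "convergent (\<lambda>k. (4 * \<theta>) * ((l2 * Phi a k + Psi k) - (l1 * Phi a k + Psi k)))"
    using convergent_mult[OF convergent_const convergent_diff[OF E2 E1(1)]] .
  also have "(\<lambda>k. (4 * \<theta>) * ((l2 * Phi a k + Psi k) - (l1 * Phi a k + Psi k))) = Phi a"
    using \<theta> by (auto simp: l1_def l2_def field_simps)
  finally show Phi: "convergent (Phi a)" .
  have "convergent (\<lambda>k. (l1 * Phi a k + Psi k) - l1 * Phi a k)"
    by (intro convergent_diff E1 convergent_mult convergent_const Phi)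
  then obtain L where L: "Psi \<longlonglongrightarrow> L" by (auto simp: convergent_def)
  have Psi0: "Psi k \<ge> 0" for k by (simp add: Psi_def)
  have "L = 0"
  proof (rule ccontr)
    assume "L \<noteq> 0"
    moreover have "L \<ge> 0" using Psi0 by (intro LIMSEQ_le_const[OF L]) auto
    ultimately have L0: "L > 0" by simp
    hence "\<forall>\<^sub>F k in sequentially. L / 2 < Psi (k + 1)"
      using LIMSEQ_ignore_initial_segment[OF L, of 1] by (intro order_tendstoD) auto
    hence "\<forall>\<^sub>F k in sequentially. norm (1 / s (k + 1)) \<le> 2 / L * (1 + \<theta>\<^sup>2) * dissip k"
    proof eventually_elim
      case (elim k)
      have s: "s (k + 1) > 0" using s_pos by simp
      have "L / 2 \<le> (1 + \<theta>\<^sup>2) * (s (k + 1) * dissip k)"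
        using elim Psi_le_dissip[of k] by linarith
      thus ?case using s L0 by (simp add: field_simps)
    qed
    hence "summable (\<lambda>k. 1 / s (k + 1))"
      by (rule summable_comparison_test_ev) (intro summable_mult E1)
    thus False using s_div summable_Suc_iff[of "\<lambda>k. 1 / s k"] by simp
  qed
  thus "Psi \<longlonglongrightarrow> 0" using L by simp
  obtain B1 where B1: "\<And>k. norm (l1 * Phi a k + Psi k) \<le> B1"
    using convergent_imp_Bseq[OF E1(1)] by (auto simp: Bseq_def)
  have "\<forall>\<^sub>F k in sequentially. (norm (z k - a))\<^sup>2 \<le> B1 / (l1 * (C - l1) / 4)"
    using energy_lower_bound[OF l1 a]
  proof eventually_elim
    case (elim k)
    have "l1 * (C - l1) / 4 > 0" using l1 by simp
    moreover have "l1 * (C - l1) / 4 * (norm (z k - a))\<^sup>2 \<le> B1" using elim B1[of k] by simp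
    ultimately show ?case by (simp add: pos_le_divide_eq mult.commute)
  qed
  hence "\<forall>\<^sub>F k in sequentially. norm (z k - a) \<le> sqrt (B1 / (l1 * (C - l1) / 4))"
    by eventually_elim (rule real_le_rsqrt)
  hence "Bseq (\<lambda>k. z k - a)" by (rule BfunI)
  thus "\<exists>B. \<forall>k. norm (z k - a) \<le> B" by (auto simp: Bseq_def)
qed

lemma scaled_residuals:
  assumes Psi: "Psi \<longlonglongrightarrow> 0"
  shows "(\<lambda>k. m k *\<^sub>R V (z k)) \<longlonglongrightarrow> 0" "(\<lambda>k. s k *\<^sub>R vel k) \<longlonglongrightarrow> 0"
proof -
  \<comment> \<open>The factor 8 inverts the weight \<open>1 / 8\<close> in \<open>Psi\<close> and
    also covers the square of weight \<open>1 / 2\<close>.\<close>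
  have bound: "(\<lambda>k. sqrt (8 * Psi k)) \<longlonglongrightarrow> 0"
    using tendsto_real_sqrt[OF tendsto_mult_right_zero[OF Psi, of 8]] by simp
  have le1: "norm (m k *\<^sub>R V (z k)) \<le> sqrt (8 * Psi k)" for k
    by (rule real_le_rsqrt) (simp add: Psi_def)
  have le2: "norm (mom k - (m k / 2) *\<^sub>R V (z k)) \<le> sqrt (8 * Psi k)" for k
    by (rule real_le_rsqrt) (simp add: Psi_def)
  show M: "(\<lambda>k. m k *\<^sub>R V (z k)) \<longlonglongrightarrow> 0"
    by (rule Lim_null_comparison[OF always_eventually bound]) (use le1 in blast)
  have X: "(\<lambda>k. mom k - (m k / 2) *\<^sub>R V (z k)) \<longlonglongrightarrow> 0"
    by (rule Lim_null_comparison[OF always_eventually bound]) (use le2 in blast)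
  have "(\<lambda>k. (mom k - (m k / 2) *\<^sub>R V (z k)) - (1 / 2) *\<^sub>R (m k *\<^sub>R V (z k))) \<longlonglongrightarrow> 0 - (1 / 2) *\<^sub>R 0"
    by (intro tendsto_intros X M)
  also have "(\<lambda>k. (mom k - (m k / 2) *\<^sub>R V (z k)) - (1 / 2) *\<^sub>R (m k *\<^sub>R V (z k))) = (\<lambda>k. s k *\<^sub>R vel k)"
    by (rule ext) (simp add: mom_minus_half)
  finally show "(\<lambda>k. s k *\<^sub>R vel k) \<longlonglongrightarrow> 0" by simp
qed

text \<open>The momentum tends to 0 and the distances are bounded, so the pairing in
  \<open>Phi\<close> vanishes in the limit; dividing by \<open>c k / 2\<close>, whose limit is
  positive, isolates the squared distance.\<close>

lemma convergent_distance:
  assumes Phi: "convergent (Phi a)" and Psi: "Psi \<longlonglongrightarrow> 0" and B: "\<And>k. norm (z k - a) \<le> B"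
  shows "convergent (\<lambda>k. (norm (z k - a))\<^sup>2)"
proof -
  obtain p where p: "Phi a \<longlonglongrightarrow> p" using Phi by (auto simp: convergent_def)
  have Cpos: "C > 0" using C \<theta> by (smt (verit) mult_nonneg_nonpos divide_nonneg_nonneg)
  have mom0: "mom \<longlonglongrightarrow> 0"
    using tendsto_add[OF scaled_residuals(2)[OF Psi] scaled_residuals(1)[OF Psi]] by (simp add: mom_def[abs_def])
  have "(\<lambda>k. inner (z k - a) (mom k)) \<longlonglongrightarrow> 0"
  proof (rule Lim_null_comparison)
    show "(\<lambda>k. B * norm (mom k)) \<longlonglongrightarrow> 0" by (intro tendsto_mult_right_zero tendsto_norm_zero mom0)
    show "\<forall>\<^sub>F k in sequentially. norm (inner (z k - a) (mom k)) \<le> B * norm (mom k)"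
    proof (intro always_eventually allI)
      fix k
      have "norm (inner (z k - a) (mom k)) \<le> norm (z k - a) * norm (mom k)"
        using Cauchy_Schwarz_ineq2 by simp
      also have "\<dots> \<le> B * norm (mom k)" using B by (intro mult_right_mono) auto
      finally show "norm (inner (z k - a) (mom k)) \<le> B * norm (mom k)" .
    qed
  qed
  hence "(\<lambda>k. (Phi a k - inner (z k - a) (mom k)) / (c k / 2)) \<longlonglongrightarrow> (p - 0) / (C / 2)"
    using Cpos by (intro tendsto_intros p c_lim) auto
  moreover have "\<forall>\<^sub>F k in sequentially. (Phi a k - inner (z k - a) (mom k)) / (c k / 2) = (norm (z k - a))\<^sup>2"
    using order_tendstoD(1)[OF c_lim Cpos] by eventually_elim (simp add: Phi_def)
  ultimately have "(\<lambda>k. (norm (z k - a))\<^sup>2) \<longlonglongrightarrow> (p - 0) / (C / 2)" by (rule Lim_transform_eventually)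
  thus ?thesis by (rule convergentI)
qed

end

section \<open>Convergence of the algorithm\<close>

lemma not_summable_inverse_powr:
  fixes r :: real
  assumes "0 < r" "r \<le> 1"
  shows "\<not> summable (\<lambda>k. 1 / real k powr r)"
proof
  assume "summable (\<lambda>k. 1 / real k powr r)"
  hence "summable (\<lambda>k. inverse (of_nat k) :: real)"
  proof (rule summable_comparison_test_ev[rotated])
    show "\<forall>\<^sub>F k in sequentially. norm (inverse (of_nat k) :: real) \<le> 1 / real k powr r"
      using eventually_ge_at_top[of "1::nat"]
    proof eventually_elim
      case (elim k)
      have "real k powr r \<le> real k powr 1" using assms elim by (intro powr_mono) auto
      thus ?case using elim by (simp add: divide_simps)
    qed
  qed
  thus False using not_summable_harmonic[where 'a = real] by simp
qed

text \<open>The Taylor remainder is at most of order \<open>k powr (2 * r - 2)\<close>, which is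
  negligible against \<open>k powr r\<close>. For \<open>r = 1\<close> it is the constant 1.\<close>

lemma powr_remainder_small:
  fixes r :: real
  assumes "0 < r" "r \<le> 1"
  shows "(\<lambda>k. (real (k + 1) powr (2 * r) - real k powr (2 * r) - 2 * r * real k powr (2 * r - 1))
      / real (k + 1) powr r) \<longlonglongrightarrow> 0"
proof (cases "r = 1")
  case True
  thus ?thesis by simp real_asymp
next
  case False
  hence "r < 1" using assms by simp
  thus ?thesis using assms(1) by real_asymp
qed

theorem theorem3p6:
  fixes V :: "'a::{real_inner, complete_space} \<Rightarrow> 'a"
    and r \<alpha> \<theta> :: real
    and \<beta> :: "nat \<Rightarrow> real"
    and z :: "nat \<Rightarrow> 'a"
    and zstar :: 'a
  assumes "monotone_operator V"
    and "continuous_on UNIV V"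
    and "0 < r" and "r \<le> 1" and "\<alpha> > 0" and "\<theta> > 0"
    and "r < 1 \<Longrightarrow> 2 / \<alpha> < \<theta>"
    and "r = 1 \<Longrightarrow> 2 / (\<alpha> + 1) \<le> \<theta> \<and> \<theta> < 1 / 4"
    and "\<And>k. \<beta> k > 0"
    and "mono \<beta>"
    and "\<exists>k0\<ge>1. (SUP k\<in>{k0..}. ereal (real k powr r *
            ((\<beta> k - \<beta> (k - 1)) / \<beta> k + 2 * r / real k))) < ereal (1 / (2 * \<theta>))"
    and "\<And>k. k \<ge> 1 \<Longrightarrow>
          z (k + 1) = z k
            + (real k powr r
                / (\<alpha> - r * real k powr (r - 1) + real (k + 1) powr r)) *\<^sub>R (z k - z (k - 1))
            - (\<theta> * real k powr (2 * r) * \<beta> (k - 1)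
                / (\<alpha> - r * real k powr (r - 1) + real (k + 1) powr r)) *\<^sub>R (V (z (k + 1)) - V (z k))
            - ((\<theta> * ((real (k + 1) powr (2 * r) - real k powr (2 * r))
                        - 2 * r * real k powr (2 * r - 1)) + real k powr r)
                / (\<alpha> - r * real k powr (r - 1) + real (k + 1) powr r) * \<beta> k) *\<^sub>R V (z (k + 1))"
    and "V zstar = 0"
    and "r = 1 \<or> (r < 1 \<and> bounded (z ` {2..}))"
  shows "(\<lambda>k. norm (V (z k))) \<in> o(\<lambda>k. 1 / (real k powr (2 * r) * \<beta> k))
       \<and> (\<lambda>k. inner (z k - zstar) (V (z k))) \<in> o(\<lambda>k. 1 / (real k powr (2 * r) * \<beta> k))
       \<and> (\<lambda>k. norm (z k - z (k - 1))) \<in> o(\<lambda>k. 1 / real k powr r)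
       \<and> (\<exists>zlim. V zlim = 0 \<and> weakly_converges_to z zlim)"
proof -
  note mono = assms(1) and cont = assms(2) and r0 = assms(3) and r1 = assms(4) and \<alpha>0 = assms(5)
    and \<theta>0 = assms(6) and \<beta>0 = assms(9) and \<beta>mono = assms(10) and upd = assms(12) and zstar = assms(13)

  \<comment> \<open>Coefficients of the algorithm\<close>
  define s where "s k = real k powr r" for k
  define c where "c k = \<alpha> - r * real k powr (r - 1)" for k
  define e where "e k = real (k + 1) powr (2 * r) - real k powr (2 * r) - 2 * r * real k powr (2 * r - 1)" for k
  define rate where "rate k = real k powr r * ((\<beta> k - \<beta> (k - 1)) / \<beta> k + 2 * r / real k)" for k
  define g where "g k = 1 - \<theta> * rate k" for k
  define C where "C = (if r = 1 then \<alpha> - 1 else \<alpha>)"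
  interpret implicit_iterates V z s \<beta> \<theta> .
  have ge1: "\<forall>\<^sub>F k in sequentially. k \<ge> (1::nat)" by (rule eventually_ge_at_top)
  have s_pos: "s k > 0" if "k \<ge> 1" for k using that by (simp add: s_def)
  have s_sq: "(s k)\<^sup>2 = real k powr (2 * r)" for k
    by (simp add: s_def power2_eq_square flip: powr_add)
  have s_lim: "filterlim s at_top sequentially"
    unfolding s_def using r0 by real_asymp
  have \<beta>_le: "\<beta> (k - 1) \<le> \<beta> k" for k using \<beta>mono by (simp add: mono_def)

  have rate: "\<forall>\<^sub>F k in sequentially. rate k < 1 / (2 * \<theta>)"
  proof -
    obtain k0 where k0: "k0 \<ge> 1" "(SUP k\<in>{k0..}. ereal (rate k)) < ereal (1 / (2 * \<theta>))"
      using assms(11) unfolding rate_def by blast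
    have "rate k < 1 / (2 * \<theta>)" if "k \<ge> k0" for k
    proof -
      have "ereal (rate k) \<le> (SUP k\<in>{k0..}. ereal (rate k))" using that by (intro SUP_upper) auto
      hence "ereal (rate k) < ereal (1 / (2 * \<theta>))" using k0(2) by (rule le_less_trans)
      thus ?thesis by simp
    qed
    thus ?thesis by (auto simp: eventually_sequentially)
  qed
  \<comment> \<open>\<open>m k\<close> carries \<open>\<beta> (k - 1)\<close> but the rates are
    stated with \<open>\<beta> k\<close>. Once \<open>s k > 1 / \<theta>\<close>, the growth
    condition forces the relative increment \<open>q\<close> below \<open>1 / 2\<close>.\<close>
  have \<beta>_ratio: "\<forall>\<^sub>F k in sequentially. \<beta> k \<le> 2 * \<beta> (k - 1)"
    using rate filterlim_at_top_dense[THEN iffD1, OF s_lim, rule_format, of "1 / \<theta>"] ge1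
  proof eventually_elim
    case (elim k)
    define q where "q = (\<beta> k - \<beta> (k - 1)) / \<beta> k"
    have q: "q \<ge> 0" using \<beta>_le[of k] \<beta>0[of k] by (simp add: q_def)
    have "1 / \<theta> * q \<le> s k * (q + 2 * r / real k)"
      using elim s_pos[of k] r0 q by (intro mult_mono) auto
    also have "\<dots> < 1 / (2 * \<theta>)" using elim(1) by (simp add: rate_def s_def q_def)
    finally have "q < 1 / 2" using \<theta>0 by (simp add: field_simps)
    thus ?case using \<beta>0[of k] by (simp add: q_def field_simps)
  qed

  \<comment> \<open>The algorithm as an instance of the abstract scheme\<close>
  interpret implicit_scheme V z s \<beta> \<theta> c g e C
  proof
    \<comment> \<open>For \<open>r = 1\<close>, \<open>\<theta> * (\<alpha> - 1) = \<theta> *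
      (\<alpha> + 1) - 2 * \<theta> > 3 / 2\<close>; for \<open>r < 1\<close>,
      \<open>\<theta> * \<alpha> > 2\<close>.\<close>
    show "9 / 8 < \<theta> * C"
    proof (cases "r = 1")
      case True
      hence "2 \<le> \<theta> * (\<alpha> + 1)" "\<theta> < 1 / 4" using assms(8) \<alpha>0 by (auto simp: divide_le_eq)
      thus ?thesis using True by (simp add: C_def algebra_simps)
    next
      case False
      hence "2 < \<theta> * \<alpha>" using assms(7) r1 \<alpha>0 by (auto simp: divide_less_eq)
      thus ?thesis using False by (simp add: C_def)
    qed
    \<comment> \<open>The increment of \<open>m\<close> is split into the growth of
      \<open>\<beta>\<close> at fixed \<open>s k\<close> and the growth of \<open>s\<^sup>2\<close>
      at fixed \<open>\<beta> k\<close>. The former and the first-order Taylor part of the latter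
      make up the term with \<open>1 - g k\<close>; \<open>e k\<close> is the rest.\<close>
    show m_step: "m (k + 1) - m k = s k * \<beta> k * (1 - g k) + \<theta> * \<beta> k * e k" if k: "k \<ge> 1" for k
    proof -
      have "real k powr (2 * r - 1) = (s k)\<^sup>2 / real k"
        using k by (simp add: s_sq powr_diff)
      hence e: "e k = (s (k + 1))\<^sup>2 - (s k)\<^sup>2 - 2 * r * ((s k)\<^sup>2 / real k)"
        by (simp add: e_def s_sq)
      have "s k * \<beta> k * (1 - g k) = \<theta> * (s k)\<^sup>2 * ((\<beta> k - \<beta> (k - 1)) / \<beta> k * \<beta> k + 2 * r / real k * \<beta> k)"
        by (simp add: g_def rate_def s_def power2_eq_square algebra_simps)
      also have "(\<beta> k - \<beta> (k - 1)) / \<beta> k * \<beta> k = \<beta> k - \<beta> (k - 1)" using \<beta>0[of k] by simp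
      finally show ?thesis by (simp add: e m_def algebra_simps)
    qed
    show "mom k = mom (k + 1) + c k *\<^sub>R vel (k + 1) + (s k * \<beta> k * g k) *\<^sub>R V (z (k + 1))" if k: "k \<ge> 1" for k
    proof -
      \<comment> \<open>The common denominator of the algorithm, positive because
        \<open>r * real k powr (r - 1) \<le> 1 \<le> s (k + 1)\<close>.\<close>
      define D where "D = c k + s (k + 1)"
      have "real k powr (r - 1) \<le> 1" using k r1 powr_mono[of "r - 1" 0 "real k"] by simp
      hence "r * real k powr (r - 1) \<le> 1" using r0 r1 by (intro mult_le_one) auto
      moreover have "1 \<le> s (k + 1)" using r0 by (simp add: s_def ge_one_powr_ge_zero)
      ultimately have D: "D > 0" using \<alpha>0 by (simp add: D_def c_def)
      have shift: "p - q = u - v - w" if "p = q + u - v - w" for p q u v w :: 'a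
        using that by simp
      have "z (k + 1) - z k = (s k / D) *\<^sub>R vel k - (m k / D) *\<^sub>R (V (z (k + 1)) - V (z k))
          - ((\<theta> * e k + s k) / D * \<beta> k) *\<^sub>R V (z (k + 1))"
        using shift[OF upd[OF k]] by (simp add: vel_def D_def c_def s_def m_def e_def s_sq[unfolded s_def])
      hence "D *\<^sub>R vel (k + 1) = D *\<^sub>R ((s k / D) *\<^sub>R vel k - (m k / D) *\<^sub>R (V (z (k + 1)) - V (z k))
          - ((\<theta> * e k + s k) / D * \<beta> k) *\<^sub>R V (z (k + 1)))" by (simp add: vel_def)
      also have "\<dots> = s k *\<^sub>R vel k - m k *\<^sub>R (V (z (k + 1)) - V (z k)) - ((\<theta> * e k + s k) * \<beta> k) *\<^sub>R V (z (k + 1))"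
        using D by (simp add: scaleR_diff_right)
      finally have eq: "s k *\<^sub>R vel k + m k *\<^sub>R V (z k)
          = D *\<^sub>R vel (k + 1) + m k *\<^sub>R V (z (k + 1)) + ((\<theta> * e k + s k) * \<beta> k) *\<^sub>R V (z (k + 1))"
        by (simp add: algebra_simps)
      \<comment> \<open>Trading \<open>m k\<close> for \<open>m (k + 1)\<close> completes the new
        momentum and leaves exactly the coefficient with \<open>g k\<close>.\<close>
      have "m k + (\<theta> * e k + s k) * \<beta> k = m (k + 1) + s k * \<beta> k * g k"
        using m_step[OF k] by (simp add: algebra_simps)
      hence "m k *\<^sub>R V (z (k + 1)) + ((\<theta> * e k + s k) * \<beta> k) *\<^sub>R V (z (k + 1))
          = m (k + 1) *\<^sub>R V (z (k + 1)) + (s k * \<beta> k * g k) *\<^sub>R V (z (k + 1))"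
        by (simp only: scaleR_left_distrib[symmetric])
      thus ?thesis unfolding mom_def eq D_def by (simp add: scaleR_left_distrib add_ac)
    qed
    show "\<forall>\<^sub>F k in sequentially. 1 / 2 \<le> g k \<and> g k \<le> 1"
      using rate ge1
    proof eventually_elim
      case (elim k)
      have "0 \<le> rate k"
        using r0 \<beta>_le[of k] \<beta>0[of k] unfolding rate_def by (intro mult_nonneg_nonneg add_nonneg_nonneg) auto
      moreover have "\<theta> * rate k \<le> 1 / 2" using elim(1) \<theta>0 by (simp add: field_simps)
      ultimately show ?case using \<theta>0 by (simp add: g_def)
    qed
    show "c \<longlonglongrightarrow> C"
    proof (cases "r = 1")
      case True
      show ?thesis
        by (rule tendsto_eventually, use ge1 in eventually_elim) (simp add: c_def C_def True)
    next
      case False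
      hence "r < 1" using r1 by simp
      hence "(\<lambda>k. real k powr (r - 1)) \<longlonglongrightarrow> 0" by real_asymp
      hence "(\<lambda>k. \<alpha> - r * real k powr (r - 1)) \<longlonglongrightarrow> \<alpha> - r * 0" by (intro tendsto_intros)
      thus ?thesis using False by (simp add: c_def[abs_def] C_def)
    qed
    show "(\<lambda>k. s k / s (k + 1)) \<longlonglongrightarrow> 1" unfolding s_def using r0 by real_asymp
    show "(\<lambda>k. e k / s (k + 1)) \<longlonglongrightarrow> 0" unfolding s_def e_def by (rule powr_remainder_small[OF r0 r1])
    show "\<not> summable (\<lambda>k. 1 / s k)" unfolding s_def by (rule not_summable_inverse_powr[OF r0 r1])
  qed (use mono \<theta>0 s_pos \<beta>0 s_lim in auto)

  \<comment> \<open>Limits of the energies at every zero\<close>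
  have limits: "convergent (Phi a)" "Psi \<longlonglongrightarrow> 0" "\<exists>B. \<forall>k. norm (z k - a) \<le> B" if a: "V a = 0" for a
  proof -
    \<comment> \<open>For \<open>r = 1\<close>, \<open>c\<close> is constant from index 1 on, so any
      \<open>K\<close> works. For \<open>r < 1\<close> it is nondecreasing there, and boundedness
      from index 2 on covers every \<open>z (k + 1)\<close> with \<open>k \<ge> 1\<close>.\<close>
    have "\<exists>K. \<forall>k\<ge>1. (c (k + 1) - c k) * (norm (z (k + 1) - a))\<^sup>2 \<le> K * (c (k + 1) - c k)"
      using assms(14)
    proof
      assume "r = 1"
      thus ?thesis by (simp add: c_def)
    next
      assume r: "r < 1 \<and> bounded (z ` {2..})"
      then obtain B where B: "\<And>k. k \<ge> 2 \<Longrightarrow> norm (z k) \<le> B" by (auto simp: bounded_iff)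
      have "(c (k + 1) - c k) * (norm (z (k + 1) - a))\<^sup>2 \<le> (B + norm a)\<^sup>2 * (c (k + 1) - c k)" if k: "k \<ge> 1" for k
      proof -
        have "real (k + 1) powr (r - 1) \<le> real k powr (r - 1)" using k r by (intro powr_mono2') auto
        hence "0 \<le> c (k + 1) - c k" using r0 by (simp add: c_def mult_left_mono)
        moreover have "norm (z (k + 1) - a) \<le> B + norm a"
          using B[of "k + 1"] k norm_triangle_ineq4[of "z (k + 1)" a] by simp
        hence "(norm (z (k + 1) - a))\<^sup>2 \<le> (B + norm a)\<^sup>2" by (rule power_mono) simp
        ultimately show ?thesis by (subst mult.commute) (rule mult_right_mono)
      qed
      thus ?thesis by blast
    qed
    then obtain K where "\<And>k. k \<ge> 1 \<Longrightarrow> (c (k + 1) - c k) * (norm (z (k + 1) - a))\<^sup>2 \<le> K * (c (k + 1) - c k)" by blast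
    from energy_limits[OF a this]
    show "convergent (Phi a)" "Psi \<longlonglongrightarrow> 0" "\<exists>B. \<forall>k. norm (z k - a) \<le> B" by auto
  qed
  note residuals = scaled_residuals[OF limits(2)[OF zstar]]
  obtain B where B: "\<And>k. norm (z k - zstar) \<le> B" using limits(3)[OF zstar] by blast

  \<comment> \<open>Rate for the operator values\<close>
  have V_rate: "(\<lambda>k. norm (V (z k)) * (real k powr (2 * r) * \<beta> k)) \<longlonglongrightarrow> 0"
  proof (rule Lim_null_comparison)
    show "(\<lambda>k. 2 / \<theta> * norm (m k *\<^sub>R V (z k))) \<longlonglongrightarrow> 0"
      by (intro tendsto_mult_right_zero tendsto_norm_zero residuals)
    show "\<forall>\<^sub>F k in sequentially. norm (norm (V (z k)) * (real k powr (2 * r) * \<beta> k)) \<le> 2 / \<theta> * norm (m k *\<^sub>R V (z k))"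
      using \<beta>_ratio
    proof eventually_elim
      case (elim k)
      have "norm (norm (V (z k)) * (real k powr (2 * r) * \<beta> k)) = norm (V (z k)) * (real k powr (2 * r) * \<beta> k)"
        using \<beta>0[of k] by (simp add: abs_mult)
      also have "\<dots> \<le> norm (V (z k)) * (real k powr (2 * r) * (2 * \<beta> (k - 1)))"
        using elim by (intro mult_left_mono) auto
      also have "\<dots> = 2 / \<theta> * norm (m k *\<^sub>R V (z k))"
        using \<theta>0 \<beta>0[of "k - 1"] by (simp add: m_def s_sq abs_mult)
      finally show ?case .
    qed
  qed
  have V_lim: "(\<lambda>k. V (z k)) \<longlonglongrightarrow> 0"
  proof (rule Lim_null_comparison)
    show "(\<lambda>k. 1 / \<beta> 0 * (norm (V (z k)) * (real k powr (2 * r) * \<beta> k))) \<longlonglongrightarrow> 0"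
      by (intro tendsto_mult_right_zero V_rate)
    show "\<forall>\<^sub>F k in sequentially. norm (V (z k)) \<le> 1 / \<beta> 0 * (norm (V (z k)) * (real k powr (2 * r) * \<beta> k))"
      using ge1
    proof eventually_elim
      case (elim k)
      have "1 * \<beta> 0 \<le> real k powr (2 * r) * \<beta> k"
        using elim r0 \<beta>0 \<beta>mono by (intro mult_mono) (auto simp: ge_one_powr_ge_zero mono_def less_imp_le)
      hence "norm (V (z k)) * \<beta> 0 \<le> norm (V (z k)) * (real k powr (2 * r) * \<beta> k)" by (simp add: mult_left_mono)
      thus ?case using \<beta>0[of 0] by (simp add: field_simps)
    qed
  qed
  have nonzero: "\<forall>\<^sub>F k in sequentially. 1 / (real k powr (2 * r) * \<beta> k) \<noteq> 0"
    "\<forall>\<^sub>F k in sequentially. 1 / real k powr r \<noteq> 0"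
    using ge1 by (eventually_elim, use \<beta>0 in \<open>simp add: less_imp_neq[symmetric]\<close>)+

  \<comment> \<open>Little-o rates and weak convergence\<close>
  show ?thesis
  proof (intro conjI)
    show "(\<lambda>k. norm (V (z k))) \<in> o(\<lambda>k. 1 / (real k powr (2 * r) * \<beta> k))"
      using V_rate by (intro smalloI_tendsto nonzero) simp
    show "(\<lambda>k. inner (z k - zstar) (V (z k))) \<in> o(\<lambda>k. 1 / (real k powr (2 * r) * \<beta> k))"
    proof (intro smalloI_tendsto nonzero)
      have "(\<lambda>k. inner (z k - zstar) (V (z k)) * (real k powr (2 * r) * \<beta> k)) \<longlonglongrightarrow> 0"
      proof (rule Lim_null_comparison)
        show "(\<lambda>k. B * (norm (V (z k)) * (real k powr (2 * r) * \<beta> k))) \<longlonglongrightarrow> 0"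
          by (intro tendsto_mult_right_zero V_rate)
        have "norm (inner (z k - zstar) (V (z k)) * (real k powr (2 * r) * \<beta> k))
            \<le> B * (norm (V (z k)) * (real k powr (2 * r) * \<beta> k))" for k
        proof -
          have "\<bar>inner (z k - zstar) (V (z k))\<bar> \<le> norm (z k - zstar) * norm (V (z k))"
            by (rule Cauchy_Schwarz_ineq2)
          also have "\<dots> \<le> B * norm (V (z k))" using B by (intro mult_right_mono) auto
          finally have "\<bar>inner (z k - zstar) (V (z k))\<bar> * (real k powr (2 * r) * \<beta> k) \<le> B * norm (V (z k)) * (real k powr (2 * r) * \<beta> k)"
            using \<beta>0[of k] by (intro mult_right_mono) auto
          thus ?thesis using \<beta>0[of k] by (simp add: abs_mult mult.assoc)
        qed
        thus "\<forall>\<^sub>F k in sequentially. norm (inner (z k - zstar) (V (z k)) * (real k powr (2 * r) * \<beta> k))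
            \<le> B * (norm (V (z k)) * (real k powr (2 * r) * \<beta> k))" by simp
      qed
      thus "(\<lambda>k. inner (z k - zstar) (V (z k)) / (1 / (real k powr (2 * r) * \<beta> k))) \<longlonglongrightarrow> 0" by simp
    qed
    show "(\<lambda>k. norm (z k - z (k - 1))) \<in> o(\<lambda>k. 1 / real k powr r)"
      using tendsto_norm_zero[OF residuals(2)]
      by (intro smalloI_tendsto nonzero) (simp add: vel_def s_def mult.commute)
    have "norm (z k) \<le> B + norm zstar" for k
      using B[of k] norm_triangle_ineq2[of "z k" zstar] by simp
    moreover have "convergent (\<lambda>k. (norm (z k - a))\<^sup>2)" if a: "V a = 0" for a
      using limits[OF a] convergent_distance by blast
    ultimately obtain l where "V l = 0" "weakly_converges_to z l"
      using weakly_converges_to_zero[OF mono cont _ V_lim] by metis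
    thus "\<exists>zlim. V zlim = 0 \<and> weakly_converges_to z zlim" by blast
  qed
qed

end
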